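(* Let $F\equiv0$, $\delta=0$, $S>0$, $m,n,i,k\in\mathbb{N}$ (positive integers) and $P<\min\{\Lambda_{m,i},\Lambda_{n,k}\}$. Suppose that either $$\frac nm\sqrt{\frac{\Lambda_{n,k}-P}{\Lambda_{m,i}-P}}\notin\mathbb{N}^+,$$ or $$\frac nm\sqrt{\frac{\Lambda_{n,k}-P}{\Lambda_{m,i}-P}}\in\mathbb{N}^+\quad\text{and}\quad 4n^2<3m^2 .$$ Then any $(m,i)$-simple mode with sufficiently small energy $E_0$ is $(n,k)$ linearly stable (i.e. there is $\overline E>0$ such that every $(m,i)$-simple mode with energy $E_0\le\overline E$ is $(n,k)$ linearly stable).
   Context: $\mathbb{N}^+$ denotes the positive integers. Let $0<\sigma<\frac12$, $l>0$ and $\Omega=(0,\pi)\times(-l,l)$. Consider the undamped, unforced plate equation $U_{tt}+\Delta^2U-\phi(U)U_{xx}=0$ in $\Omega\times(0,\infty)$, $\phi(U)=-P+S\int_\Omega U_x^2$, with boundary conditions $U=U_{xx}=0$ on $\{0,\pi\}\times[-l,l]$, $U_{yy}+\sigma U_{xx}=U_{yyy}+(2-\sigma)U_{xxy}=0$ on $[0,\pi]\times\{-l,l\}$. Let $w_{mi}(x,y)=\varphi_{m,i}(y)\sin(mx)$, $m,i\ge1$, be the complete orthogonal system of eigenfunctions of the buckling problem $\Delta^2w+\Lambda w_{xx}=0$ in $\Omega$ with the same boundary conditions, with eigenvalues $\Lambda_{m,i}>0$, so that $\Delta^2w_{mi}=-\Lambda_{m,i}(w_{mi})_{xx}=m^2\Lambda_{m,i}w_{mi}$,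 normalized by $\int_\Omega w_{mi}^2=1$. An $(m,i)$-simple mode is a solution of the plate equation of the form $U(x,y,t)=\varphi(t)w_{mi}(x,y)$ with $\varphi\in C^2([0,\infty),\mathbb{R})$; equivalently, its coordinate $\varphi$ solves $\varphi''+m^2(\Lambda_{m,i}-P)\varphi+Sm^4\varphi^3=0$. Its (conserved) energy is $E_0=\frac{(\varphi')^2}{2}+m^2(\Lambda_{m,i}-P)\frac{\varphi^2}{2}+S\frac{m^4\varphi^4}{4}$. The $(m,i)$-simple mode $\varphi(t)w_{mi}$ is $(n,k)$ linearly stable if $\xi\equiv0$ is a stable solution of the linear Hill equation $\xi''+a(t)\xi=0$, $a(t)=n^2(\Lambda_{n,k}-P)+Sm^2n^2\varphi(t)^2$ (equivalently, all its solutions are bounded). *)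

theory Defs
  imports "HOL-Analysis.Analysis"
begin

text \<open>One-sided derivatives at the end points of an interval are obtained by restricting the
  filter, so that regularity up to the boundary makes sense. Values outside \<open>A\<close> are irrelevant.\<close>

definition deriv_on :: "real set \<Rightarrow> (real \<Rightarrow> real) \<Rightarrow> real \<Rightarrow> real" where
  "deriv_on A f x = vector_derivative f (at x within A)"

definition C2_halfline :: "(real \<Rightarrow> real) \<Rightarrow> bool" where
  "C2_halfline f \<longleftrightarrow>
     f differentiable_on {0..} \<and>
     deriv_on {0..} f differentiable_on {0..} \<and>
     continuous_on {0..} (deriv_on {0..} (deriv_on {0..} f))"

definition plate :: "real \<Rightarrow> (real \<times> real) set" where
  "plate l = {0<..<pi} \<times> {-l<..<l}"

definition closed_plate :: "real \<Rightarrow> (real \<times> real) set" where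
  "closed_plate l = {0..pi} \<times> {-l..l}"

definition dx :: "(real \<times> real \<Rightarrow> real) \<Rightarrow> real \<times> real \<Rightarrow> real" where
  "dx f p = deriv_on {0..pi} (\<lambda>s. f (s, snd p)) (fst p)"

definition dy :: "real \<Rightarrow> (real \<times> real \<Rightarrow> real) \<Rightarrow> real \<times> real \<Rightarrow> real" where
  "dy l f p = deriv_on {-l..l} (\<lambda>s. f (fst p, s)) (snd p)"

definition laplacian :: "real \<Rightarrow> (real \<times> real \<Rightarrow> real) \<Rightarrow> real \<times> real \<Rightarrow> real" where
  "laplacian l f p = dx (dx f) p + dy l (dy l f) p"

primrec Ck_closed_plate :: "real \<Rightarrow> nat \<Rightarrow> (real \<times> real \<Rightarrow> real) \<Rightarrow> bool" where
  "Ck_closed_plate l 0 f \<longleftrightarrow> continuous_on (closed_plate l) f"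
| "Ck_closed_plate l (Suc k) f \<longleftrightarrow>
     continuous_on (closed_plate l) f \<and>
     (\<forall>y\<in>{-l..l}. (\<lambda>x. f (x, y)) differentiable_on {0..pi}) \<and>
     (\<forall>x\<in>{0..pi}. (\<lambda>y. f (x, y)) differentiable_on {-l..l}) \<and>
     Ck_closed_plate l k (dx f) \<and> Ck_closed_plate l k (dy l f)"

text \<open>Hinged short edges \<open>x = 0, \<pi>\<close> and free long edges \<open>y = -l, l\<close>.\<close>

definition plate_bc :: "real \<Rightarrow> real \<Rightarrow> (real \<times> real \<Rightarrow> real) \<Rightarrow> bool" where
  "plate_bc \<sigma> l f \<longleftrightarrow>
     (\<forall>x\<in>{0, pi}. \<forall>y\<in>{-l..l}. f (x, y) = 0 \<and> dx (dx f) (x, y) = 0) \<and>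
     (\<forall>x\<in>{0..pi}. \<forall>y\<in>{-l, l}.
        dy l (dy l f) (x, y) + \<sigma> * dx (dx f) (x, y) = 0 \<and>
        dy l (dy l (dy l f)) (x, y) + (2 - \<sigma>) * dy l (dx (dx f)) (x, y) = 0)"

definition buckling_eigenfunction ::
  "real \<Rightarrow> real \<Rightarrow> real \<Rightarrow> (real \<times> real \<Rightarrow> real) \<Rightarrow> bool" where
  "buckling_eigenfunction \<sigma> l \<mu> f \<longleftrightarrow>
     Ck_closed_plate l 4 f \<and> plate_bc \<sigma> l f \<and>
     (\<exists>p\<in>plate l. f p \<noteq> 0) \<and>
     (\<forall>p\<in>plate l. laplacian l (laplacian l f) p + \<mu> * dx (dx f) p = 0)"

definition mode_shape :: "(nat \<Rightarrow> nat \<Rightarrow> real \<Rightarrow> real) \<Rightarrow> nat \<Rightarrow> nat \<Rightarrow> real \<times> real \<Rightarrow> real" where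
  "mode_shape \<psi> m i p = \<psi> m i (snd p) * sin (real m * fst p)"

text \<open>Orthogonality and completeness are those of \<open>L\<^sup>2\<close> of the plate. For eigenfunctions of this
  problem with separated variables they are equivalent to the same properties in the energy space,
  since the energy product of \<open>v\<close> with the \<open>(m,i)\<close>-th eigenfunction is \<open>m\<^sup>2 \<Lambda> m i\<close> times their
  \<open>L\<^sup>2\<close> product.\<close>

definition buckling_system ::
  "real \<Rightarrow> real \<Rightarrow> (nat \<Rightarrow> nat \<Rightarrow> real \<Rightarrow> real) \<Rightarrow> (nat \<Rightarrow> nat \<Rightarrow> real) \<Rightarrow> bool" where
  "buckling_system \<sigma> l \<psi> \<Lambda> \<longleftrightarrow>
     (\<forall>m\<ge>1. \<forall>i\<ge>1. \<Lambda> m i > 0 \<and>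
        buckling_eigenfunction \<sigma> l (\<Lambda> m i) (mode_shape \<psi> m i) \<and>
        (LINT p:plate l|lborel. (mode_shape \<psi> m i p)\<^sup>2) = 1) \<and>
     (\<forall>m\<ge>1. \<forall>i\<ge>1. \<forall>n\<ge>1. \<forall>k\<ge>1. (m, i) \<noteq> (n, k) \<longrightarrow>
        (LINT p:plate l|lborel. mode_shape \<psi> m i p * mode_shape \<psi> n k p) = 0) \<and>
     (\<forall>f :: real \<times> real \<Rightarrow> real.
        f \<in> borel_measurable lborel \<longrightarrow>
        set_integrable lborel (plate l) (\<lambda>p. (f p)\<^sup>2) \<longrightarrow>
        (\<forall>m\<ge>1. \<forall>i\<ge>1. (LINT p:plate l|lborel. f p * mode_shape \<psi> m i p) = 0) \<longrightarrow>
        (AE p in lborel. p \<in> plate l \<longrightarrow> f p = 0))"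

definition nonlocal_coeff ::
  "real \<Rightarrow> real \<Rightarrow> real \<Rightarrow> (real \<times> real \<Rightarrow> real) \<Rightarrow> real" where
  "nonlocal_coeff l P S u = - P + S * (LINT p:plate l|lborel. (dx u p)\<^sup>2)"

text \<open>Classical solutions; the time slice \<open>U t\<close> is a function on the plate.\<close>

definition plate_solution ::
  "real \<Rightarrow> real \<Rightarrow> real \<Rightarrow> real \<Rightarrow> (real \<Rightarrow> real \<times> real \<Rightarrow> real) \<Rightarrow> bool" where
  "plate_solution \<sigma> l P S U \<longleftrightarrow>
     (\<forall>t\<ge>0. Ck_closed_plate l 4 (U t) \<and> plate_bc \<sigma> l (U t)) \<and>
     (\<forall>p\<in>closed_plate l. C2_halfline (\<lambda>t. U t p)) \<and>
     (\<forall>p\<in>plate l. \<forall>t>0.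
        deriv_on {0..} (deriv_on {0..} (\<lambda>s. U s p)) t
          + laplacian l (laplacian l (U t)) p
          - nonlocal_coeff l P S (U t) * dx (dx (U t)) p = 0)"

text \<open>A simple mode is represented by its time coordinate \<open>\<phi>\<close>.\<close>

definition simple_mode ::
  "real \<Rightarrow> real \<Rightarrow> real \<Rightarrow> real \<Rightarrow> (nat \<Rightarrow> nat \<Rightarrow> real \<Rightarrow> real) \<Rightarrow> nat \<Rightarrow> nat \<Rightarrow>
     (real \<Rightarrow> real) \<Rightarrow> bool" where
  "simple_mode \<sigma> l P S \<psi> m i \<phi> \<longleftrightarrow>
     C2_halfline \<phi> \<and> plate_solution \<sigma> l P S (\<lambda>t p. \<phi> t * mode_shape \<psi> m i p)"

definition mode_energy ::
  "real \<Rightarrow> real \<Rightarrow> (nat \<Rightarrow> nat \<Rightarrow> real) \<Rightarrow> nat \<Rightarrow> nat \<Rightarrow> (real \<Rightarrow> real) \<Rightarrow> real \<Rightarrow> real" where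
  "mode_energy P S \<Lambda> m i \<phi> t =
     (deriv_on {0..} \<phi> t)\<^sup>2 / 2 + (real m)\<^sup>2 * (\<Lambda> m i - P) * (\<phi> t)\<^sup>2 / 2
       + S * (real m)^4 * (\<phi> t)^4 / 4"

definition hill_solution :: "(real \<Rightarrow> real) \<Rightarrow> (real \<Rightarrow> real) \<Rightarrow> bool" where
  "hill_solution a \<xi> \<longleftrightarrow>
     C2_halfline \<xi> \<and> (\<forall>t\<ge>0. deriv_on {0..} (deriv_on {0..} \<xi>) t + a t * \<xi> t = 0)"

text \<open>Lyapunov stability, in the phase plane, of the zero solution.\<close>

definition hill_zero_stable :: "(real \<Rightarrow> real) \<Rightarrow> bool" where
  "hill_zero_stable a \<longleftrightarrow>
     (\<forall>\<epsilon>>0. \<exists>\<eta>>0. \<forall>\<xi>. hill_solution a \<xi> \<longrightarrow>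
        \<bar>\<xi> 0\<bar> < \<eta> \<longrightarrow> \<bar>deriv_on {0..} \<xi> 0\<bar> < \<eta> \<longrightarrow>
        (\<forall>t\<ge>0. \<bar>\<xi> t\<bar> < \<epsilon> \<and> \<bar>deriv_on {0..} \<xi> t\<bar> < \<epsilon>))"

definition linearly_stable ::
  "real \<Rightarrow> real \<Rightarrow> (nat \<Rightarrow> nat \<Rightarrow> real) \<Rightarrow> nat \<Rightarrow> nat \<Rightarrow> nat \<Rightarrow> (real \<Rightarrow> real) \<Rightarrow> bool" where
  "linearly_stable P S \<Lambda> m n k \<phi> \<longleftrightarrow>
     hill_zero_stable
       (\<lambda>t. (real n)\<^sup>2 * (\<Lambda> n k - P) + S * (real m)\<^sup>2 * (real n)\<^sup>2 * (\<phi> t)\<^sup>2)"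

end

theory Submission
  imports Defs
begin

text \<open>
  Separation of variables turns a simple mode into a solution of the Duffing equation
  \<open>\<phi>'' + \<omega>\<^sup>2 \<phi> + \<kappa> \<phi>\<^sup>3 = 0\<close> with \<open>\<omega> = m \<surd>(\<Lambda>\<^sub>m\<^sub>i - P)\<close> and \<open>\<kappa> = S m\<^sup>4\<close>
  (\<open>simple_mode_duffing\<close>), and the question becomes the stability of Hill's equation with
  coefficient \<open>a = \<alpha>\<^sup>2 + s \<phi>\<^sup>2\<close>, where \<open>\<alpha> = n \<surd>(\<Lambda>\<^sub>n\<^sub>k - P)\<close> and \<open>s = S m\<^sup>2 n\<^sup>2\<close>.
  Every solution of the Duffing equation is antiperiodic over its half period \<open>\<tau>\<close>, so \<open>a\<close> has
  period \<open>\<tau>\<close>; the half period depends only on the amplitude \<open>A\<close> and is an explicit integral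
  (\<open>duffing_half_period_antiperiodic\<close>).

  Stability then follows from Zhukovskii's criterion (\<open>zhukovskii_bounded\<close>): all solutions are
  bounded if, for some natural number \<open>K\<close>, the frequency \<open>\<surd>a\<close> stays strictly between \<open>K\<pi>/\<tau>\<close> and
  \<open>(K + 1)\<pi>/\<tau>\<close>. If some solution were unbounded, a nonzero solution would be multiplied by a real number over one
  period, so that its phase vector would turn by an integer multiple of \<open>\<pi>\<close>; but comparison with
  constant frequencies confines this rotation strictly between \<open>K\<pi>\<close> and \<open>(K + 1)\<pi>\<close>
  (\<open>wronskian_shift_nonzero\<close>).

  As the energy tends to zero, \<open>a\<close> tends to \<open>\<alpha>\<^sup>2\<close> uniformly and \<open>\<tau>\<close> tends to \<open>\<pi>/\<omega>\<close>. If \<open>\<alpha>/\<omega>\<close> is not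
  an integer, the criterion therefore holds with \<open>K = \<lfloor>\<alpha>/\<omega>\<rfloor>\<close>. If \<open>\<alpha> = N \<omega>\<close> with an integer \<open>N\<close>, it
  holds with \<open>K = N - 1\<close>, but the upper inequality is an equality in the limit and is decided at
  the next order in \<open>A\<close>: since \<open>\<tau> = \<pi>/\<omega> (1 - 3\<kappa>A\<^sup>2/(8\<omega>\<^sup>2) + \<dots>)\<close> and
  \<open>\<surd>(max a) = N\<omega> (1 + sA\<^sup>2/(2N\<^sup>2\<omega>\<^sup>2) + \<dots>)\<close>, the product is below \<open>N\<pi>\<close> for small \<open>A\<close> if
  \<open>4 s/N\<^sup>2 < 3 \<kappa>\<close> (\<open>duffing_half_period_less\<close>), which \<open>4 n\<^sup>2 < 3 m\<^sup>2\<close> implies. The condition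
  expresses that the hardening of the mode shortens the period faster than the amplitude
  raises the frequency of the perturbation.
\<close>

section \<open>Calculus on a half-line\<close>

lemma constant_if_deriv_0_halfline:
  fixes f :: "real \<Rightarrow> real"
  assumes "\<And>t. c \<le> t \<Longrightarrow> (f has_real_derivative 0) (at t within {c..})" "c \<le> t"
  shows "f t = f c"
proof -
  have "\<exists>k. \<forall>x\<in>{c..}. f x = k"
    by (rule has_field_derivative_zero_constant) (use assms in auto)
  with assms(2) show ?thesis by auto
qed

lemma mono_if_deriv_nonneg_halfline:
  fixes f :: "real \<Rightarrow> real"
  assumes d: "\<And>t. c \<le> t \<Longrightarrow> (f has_real_derivative f' t) (at t within {c..})"
    and nn: "\<And>t. c \<le> t \<Longrightarrow> 0 \<le> f' t" and "c \<le> t"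
  shows "f c \<le> f t"
proof (rule DERIV_nonneg_imp_increasing_open[OF \<open>c \<le> t\<close>])
  fix x assume "c < x" "x < t"
  then have "(f has_real_derivative f' x) (at x)"
    using d[of x] at_within_interior[of x "{c..}"] by auto
  then show "\<exists>y. (f has_real_derivative y) (at x) \<and> 0 \<le> y"
    using nn[of x] \<open>c < x\<close> by auto
next
  show "continuous_on {c..t} f"
    by (rule continuous_on_subset[of "{c..}"], rule DERIV_continuous_on[OF d]) auto
qed

lemma deriv_shift_halfline:
  fixes f :: "real \<Rightarrow> real"
  assumes "\<And>t. 0 \<le> t \<Longrightarrow> (f has_real_derivative f' t) (at t within {0..})" "0 \<le> s" "0 \<le> t"
  shows "((\<lambda>t. f (t + s)) has_real_derivative f' (t + s)) (at t within {0..})"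
proof -
  have "((f \<circ> (\<lambda>t. t + s)) has_real_derivative f' (t + s) * 1) (at t within {0..})"
    by (rule DERIV_image_chain)
      (use assms in \<open>auto intro!: derivative_eq_intros intro: has_field_derivative_subset[of f _ _ "{0..}"]\<close>)
  then show ?thesis by (simp add: o_def)
qed

lemma integral_has_vector_derivative_halfline:
  fixes f :: "real \<Rightarrow> 'a::banach"
  assumes "continuous_on {c..} f" "c \<le> t"
  shows "((\<lambda>u. integral {c..u} f) has_vector_derivative f t) (at t within {c..})"
proof -
  have "at t within {c..t+1} = at t within {c..}"
    by (rule at_within_nhd[where S="{..<t+1}"]) auto
  moreover have "((\<lambda>u. integral {c..u} f) has_vector_derivative f t) (at t within {c..t+1})"
    by (rule integral_has_vector_derivative) (use assms in \<open>auto intro: continuous_on_subset\<close>)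
  ultimately show ?thesis by simp
qed


text \<open>
  The continuous choice of \<open>log (z t / z 0)\<close> along a curve that avoids the origin. Its imaginary
  part is the angle swept by the curve, which serves both for the linear Hill equation and for
  the nonlinear oscillator.
\<close>

lemma complex_log_lift:
  fixes z z' :: "real \<Rightarrow> complex"
  assumes d: "\<And>t. 0 \<le> t \<Longrightarrow> (z has_vector_derivative z' t) (at t within {0..})"
    and c: "continuous_on {0..} z'" and nz: "\<And>t. 0 \<le> t \<Longrightarrow> z t \<noteq> 0"
  obtains L where "L 0 = 0"
    "\<And>t. 0 \<le> t \<Longrightarrow> (L has_vector_derivative z' t / z t) (at t within {0..})"
    "\<And>t. 0 \<le> t \<Longrightarrow> z t = z 0 * exp (L t)"
proof -
  have cz: "continuous_on {0..} z"
    using d by (auto simp: continuous_on_eq_continuous_within intro: has_vector_derivative_continuous)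
  define L where "L t = integral {0..t} (\<lambda>s. z' s / z s)" for t
  have L: "(L has_vector_derivative z' t / z t) (at t within {0..})" if "0 \<le> t" for t
    unfolding L_def
    by (rule integral_has_vector_derivative_halfline[of 0 "\<lambda>s. z' s / z s"])
       (use that nz in \<open>auto intro!: continuous_intros c cz\<close>)
  have L0: "L 0 = 0" by (simp add: L_def)
  have "z t = z 0 * exp (L t)" if t: "0 \<le> t" for t
  proof -
    have "((\<lambda>t. z t * exp (- L t)) has_vector_derivative 0) (at s within {0..})" if "0 \<le> s" for s
    proof -
      have "((exp \<circ> (\<lambda>t. - L t)) has_vector_derivative (- (z' s / z s)) * exp (- L s)) (at s within {0..})"
        by (rule field_vector_diff_chain_within)
          (use L that in \<open>auto intro!: derivative_eq_intros has_vector_derivative_minus\<close>)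
      then have "((\<lambda>t. z t * (exp \<circ> (\<lambda>t. - L t)) t) has_vector_derivative
          z s * ((- (z' s / z s)) * exp (- L s)) + z' s * (exp \<circ> (\<lambda>t. - L t)) s) (at s within {0..})"
        using d[OF that] by (intro has_vector_derivative_mult)
      then show ?thesis using nz[OF that] by (simp add: o_def)
    qed
    then obtain k where "\<And>s. s \<in> {0..} \<Longrightarrow> z s * exp (- L s) = k"
      using has_vector_derivative_zero_constant[of "{0..}" "\<lambda>t. z t * exp (- L t)"] by auto
    from this[of t] this[of 0] have "z t * exp (- L t) = z 0" using t L0 by auto
    then show ?thesis by (simp add: exp_minus field_simps)
  qed
  with L L0 that show ?thesis by blast
qed

lemma at_within_interval_neq_bot:
  fixes x :: real
  assumes "x \<in> {a..b}" "a < b"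
  shows "at x within {a..b} \<noteq> bot"
  using assms by (simp add: trivial_limit_within)

lemma at_within_halfline_neq_bot:
  fixes x :: real
  assumes "c \<le> x"
  shows "at x within {c..} \<noteq> bot"
proof -
  have "x islimpt {c..}"
  proof (rule connected_imp_perfect)
    fix y :: real
    have "y + 1 \<in> {c..} \<or> c \<notin> {y}" by auto
    then show "{c..} \<noteq> {y}" by (metis atLeast_iff add_cancel_left_right order_refl singletonD zero_neq_one)
  qed (use assms in auto)
  then show ?thesis by (simp add: trivial_limit_within)
qed

lemma deriv_on_eqI:
  assumes "at x within A \<noteq> bot" "(f has_real_derivative D) (at x within A)"
  shows "deriv_on A f x = D"
  unfolding deriv_on_def
  using assms by (auto intro!: vector_derivative_within simp: has_real_derivative_iff_has_vector_derivative)

lemma deriv_on_works: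
  assumes "f differentiable_on A" "x \<in> A"
  shows "(f has_real_derivative deriv_on A f x) (at x within A)"
  using assms unfolding deriv_on_def differentiable_on_def has_real_derivative_iff_has_vector_derivative
  by (auto simp: vector_derivative_works[symmetric])

lemma deriv_on_cong:
  assumes "\<And>s. s \<in> A \<Longrightarrow> f s = g s" "x \<in> A"
  shows "deriv_on A f x = deriv_on A g x"
  unfolding deriv_on_def by (rule vector_derivative_cong_eq) (use assms in auto)

lemma C2_halfline_derivs:
  assumes "C2_halfline f" "0 \<le> t"
  shows "(f has_real_derivative deriv_on {0..} f t) (at t within {0..})"
    and "(deriv_on {0..} f has_real_derivative deriv_on {0..} (deriv_on {0..} f) t) (at t within {0..})"
  using assms by (auto simp: C2_halfline_def intro!: deriv_on_works)


section \<open>Solutions of Hill's equation\<close>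

text \<open>
  Hill's equation \<open>\<xi>'' + a \<xi> = 0\<close> as a first-order system, with \<open>\<eta>\<close> the velocity of \<open>\<xi>\<close>. All
  derivatives at \<open>0\<close> are one-sided, so that time shifts stay within the same notion.
\<close>

definition hill_flow :: "(real \<Rightarrow> real) \<Rightarrow> (real \<Rightarrow> real) \<Rightarrow> (real \<Rightarrow> real) \<Rightarrow> bool" where
  "hill_flow a \<xi> \<eta> \<longleftrightarrow>
     (\<forall>t\<ge>0. (\<xi> has_real_derivative \<eta> t) (at t within {0..}) \<and>
            (\<eta> has_real_derivative - a t * \<xi> t) (at t within {0..}))"

lemma hill_flow_continuous:
  assumes "hill_flow a \<xi> \<eta>"
  shows "continuous_on {0..} \<xi>" "continuous_on {0..} \<eta>"
  using assms unfolding hill_flow_def by (auto intro!: DERIV_continuous_on)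

lemma hill_flow_lincomb:
  assumes "hill_flow a \<xi> \<eta>" "hill_flow a u v"
  shows "hill_flow a (\<lambda>t. p * \<xi> t + q * u t) (\<lambda>t. p * \<eta> t + q * v t)"
  using assms unfolding hill_flow_def
  by (auto intro!: derivative_eq_intros simp: algebra_simps)

lemma hill_flow_shift:
  assumes "hill_flow a \<xi> \<eta>" and per: "\<And>t. 0 \<le> t \<Longrightarrow> a (t + \<tau>) = a t" and "0 \<le> \<tau>"
  shows "hill_flow a (\<lambda>t. \<xi> (t + \<tau>)) (\<lambda>t. \<eta> (t + \<tau>))"
  unfolding hill_flow_def
proof (intro allI impI conjI)
  fix t :: real assume t: "0 \<le> t"
  show "((\<lambda>t. \<xi> (t + \<tau>)) has_real_derivative \<eta> (t + \<tau>)) (at t within {0..})"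
    by (rule deriv_shift_halfline) (use assms t in \<open>auto simp: hill_flow_def\<close>)
  have "((\<lambda>t. \<eta> (t + \<tau>)) has_real_derivative - a (t + \<tau>) * \<xi> (t + \<tau>)) (at t within {0..})"
    by (rule deriv_shift_halfline[of \<eta> "\<lambda>t. - a t * \<xi> t"])
       (use assms t in \<open>auto simp: hill_flow_def\<close>)
  then show "((\<lambda>t. \<eta> (t + \<tau>)) has_real_derivative - a t * \<xi> (t + \<tau>)) (at t within {0..})"
    by (simp add: per[OF t])
qed

lemma wronskian_constant:
  assumes "hill_flow a \<xi> \<eta>" "hill_flow a u v" "0 \<le> t"
  shows "\<xi> t * v t - \<eta> t * u t = \<xi> 0 * v 0 - \<eta> 0 * u 0"
  by (rule constant_if_deriv_0_halfline[where f="\<lambda>t. \<xi> t * v t - \<eta> t * u t" and c=0])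
    (use assms in \<open>auto simp: hill_flow_def intro!: derivative_eq_intros\<close>)

text \<open>
  Since \<open>\<bar>a\<bar> \<le> M\<close>, the logarithmic derivative of \<open>\<xi>\<^sup>2 + \<eta>\<^sup>2\<close> is at most \<open>1 + M\<close> in absolute value. The upper
  bound gives uniqueness, the lower bound shows that a nonzero phase vector never vanishes later.
\<close>

lemma hill_flow_growth:
  assumes flow: "hill_flow a \<xi> \<eta>" and bd: "\<And>t. 0 \<le> t \<Longrightarrow> \<bar>a t\<bar> \<le> M" and t: "0 \<le> t"
  shows "(\<xi> t)\<^sup>2 + (\<eta> t)\<^sup>2 \<le> ((\<xi> 0)\<^sup>2 + (\<eta> 0)\<^sup>2) * exp ((1 + M) * t)"
    and "((\<xi> 0)\<^sup>2 + (\<eta> 0)\<^sup>2) * exp (- (1 + M) * t) \<le> (\<xi> t)\<^sup>2 + (\<eta> t)\<^sup>2"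
proof -
  define E where "E s = (\<xi> s)\<^sup>2 + (\<eta> s)\<^sup>2" for s
  define E' where "E' s = (1 - a s) * (2 * (\<xi> s * \<eta> s))" for s
  have E: "(E has_real_derivative E' s) (at s within {0..})" if "0 \<le> s" for s
    using flow that unfolding E_def E'_def hill_flow_def
    by (auto intro!: derivative_eq_intros simp: algebra_simps)
  have bd': "\<bar>E' s\<bar> \<le> (1 + M) * E s" if "0 \<le> s" for s
  proof -
    have "\<bar>E' s\<bar> = \<bar>1 - a s\<bar> * (2 * \<bar>\<xi> s\<bar> * \<bar>\<eta> s\<bar>)"
      unfolding E'_def by (simp add: abs_mult)
    also have "\<dots> \<le> (1 + M) * E s"
      unfolding E_def using sum_squares_bound[of "\<bar>\<xi> s\<bar>" "\<bar>\<eta> s\<bar>"] bd[OF that]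
      by (intro mult_mono) auto
    finally show ?thesis .
  qed
  have mono: "E 0 * exp (c * 0) * sg \<le> E t * exp (c * t) * sg"
    if sg: "\<And>s. 0 \<le> s \<Longrightarrow> 0 \<le> (E' s + c * E s) * sg" for c sg
  proof (rule mono_if_deriv_nonneg_halfline[where f="\<lambda>s. E s * exp (c * s) * sg" and c=0])
    fix s :: real assume "0 \<le> s"
    then show "((\<lambda>s. E s * exp (c * s) * sg) has_real_derivative
        (E' s + c * E s) * sg * exp (c * s)) (at s within {0..})"
      using E by (auto intro!: derivative_eq_intros simp: algebra_simps)
    show "0 \<le> (E' s + c * E s) * sg * exp (c * s)"
      using sg \<open>0 \<le> s\<close> by auto
  qed (use t in auto)
  have e: "exp (- (1 + M) * t) * exp ((1 + M) * t) = 1"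
    unfolding exp_add[symmetric] by (simp add: algebra_simps)
  have "E t * exp (- (1 + M) * t) \<le> E 0"
    using mono[of "- (1 + M)" "-1"] bd' by (force simp: abs_le_iff algebra_simps)
  then have "E t * exp (- (1 + M) * t) * exp ((1 + M) * t) \<le> E 0 * exp ((1 + M) * t)"
    by (rule mult_right_mono) auto
  then show "(\<xi> t)\<^sup>2 + (\<eta> t)\<^sup>2 \<le> ((\<xi> 0)\<^sup>2 + (\<eta> 0)\<^sup>2) * exp ((1 + M) * t)"
    unfolding mult.assoc e by (simp add: E_def)
  have "E 0 \<le> E t * exp ((1 + M) * t)"
    using mono[of "1 + M" "1"] bd' by (force simp: abs_le_iff algebra_simps)
  then have "E 0 * exp (- (1 + M) * t) \<le> E t * exp ((1 + M) * t) * exp (- (1 + M) * t)"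
    by (rule mult_right_mono) auto
  also have "\<dots> = E t"
    using e by (simp add: mult.assoc mult.commute[of "exp ((1 + M) * t)"])
  finally show "((\<xi> 0)\<^sup>2 + (\<eta> 0)\<^sup>2) * exp (- (1 + M) * t) \<le> (\<xi> t)\<^sup>2 + (\<eta> t)\<^sup>2"
    unfolding E_def .
qed

lemma hill_flow_unique:
  assumes "hill_flow a \<xi> \<eta>" "hill_flow a u v" and bd: "\<And>t. 0 \<le> t \<Longrightarrow> \<bar>a t\<bar> \<le> M"
    and "\<xi> 0 = p * u 0 + q * u' 0" "\<eta> 0 = p * v 0 + q * v' 0" "hill_flow a u' v'" and t: "0 \<le> t"
  shows "\<xi> t = p * u t + q * u' t" "\<eta> t = p * v t + q * v' t"
proof -
  have "hill_flow a (\<lambda>t. 1 * \<xi> t + (-1) * (p * u t + q * u' t))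
                    (\<lambda>t. 1 * \<eta> t + (-1) * (p * v t + q * v' t))"
    using assms by (intro hill_flow_lincomb)
  from hill_flow_growth(1)[OF this bd t] assms(4,5)
  have "1 * \<xi> t + (-1) * (p * u t + q * u' t) = 0 \<and> 1 * \<eta> t + (-1) * (p * v t + q * v' t) = 0"
    unfolding sum_power2_le_zero_iff[symmetric] by simp
  then show "\<xi> t = p * u t + q * u' t" "\<eta> t = p * v t + q * v' t" by auto
qed

lemma hill_flow_nonzero:
  assumes "hill_flow a \<xi> \<eta>" "\<And>t. 0 \<le> t \<Longrightarrow> \<bar>a t\<bar> \<le> M" "0 \<le> t"
    and "\<xi> 0 \<noteq> 0 \<or> \<eta> 0 \<noteq> 0"
  shows "\<xi> t \<noteq> 0 \<or> \<eta> t \<noteq> 0"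
proof -
  have "0 < ((\<xi> 0)\<^sup>2 + (\<eta> 0)\<^sup>2) * exp (- (1 + M) * t)"
    using assms(4) by (simp add: sum_power2_gt_zero_iff)
  with hill_flow_growth(2)[OF assms(1-3)] have "0 < (\<xi> t)\<^sup>2 + (\<eta> t)\<^sup>2" by linarith
  then show ?thesis by (simp add: sum_power2_gt_zero_iff)
qed


section \<open>Rotation in the phase plane\<close>

text \<open>
  The Pruefer angle of a solution, measured in the phase plane after stretching the position by
  \<open>\<beta>\<close>. For \<open>a = \<beta>\<^sup>2\<close> the vector would turn with constant speed \<open>\<beta>\<close>.
\<close>

lemma hill_flow_phase:
  assumes flow: "hill_flow a \<xi> \<eta>" and cont: "continuous_on {0..} a"
    and bd: "\<And>t. 0 \<le> t \<Longrightarrow> \<bar>a t\<bar> \<le> M" and "0 < \<beta>" and nz: "\<xi> 0 \<noteq> 0 \<or> \<eta> 0 \<noteq> 0"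
  obtains L where "L 0 = 0" "continuous_on {0..} (\<lambda>t. Im (L t))"
    "\<And>t. 0 \<le> t \<Longrightarrow> ((\<lambda>t. Im (L t)) has_real_derivative
        \<beta> * ((\<eta> t)\<^sup>2 + a t * (\<xi> t)\<^sup>2) / ((\<eta> t)\<^sup>2 + \<beta>\<^sup>2 * (\<xi> t)\<^sup>2)) (at t within {0..})"
    "\<And>t. 0 \<le> t \<Longrightarrow> Complex (\<eta> t) (\<beta> * \<xi> t) = Complex (\<eta> 0) (\<beta> * \<xi> 0) * exp (L t)"
proof -
  define z where "z t = Complex (\<eta> t) (\<beta> * \<xi> t)" for t
  define z' where "z' t = Complex (- a t * \<xi> t) (\<beta> * \<eta> t)" for t
  have z: "(z has_vector_derivative z' t) (at t within {0..})" if "0 \<le> t" for t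
    using flow that unfolding z_def z'_def has_vector_derivative_complex_iff hill_flow_def
    by (auto intro!: derivative_eq_intros)
  have nz': "z t \<noteq> 0" if "0 \<le> t" for t
    using hill_flow_nonzero[OF flow bd that nz] \<open>0 < \<beta>\<close> by (auto simp: z_def complex_eq_iff)
  have c: "continuous_on {0..} z'"
    unfolding z'_def using hill_flow_continuous[OF flow] cont
    by (auto intro!: continuous_intros simp: Complex_eq)
  obtain L where L: "L 0 = 0"
      "\<And>t. 0 \<le> t \<Longrightarrow> (L has_vector_derivative z' t / z t) (at t within {0..})"
      "\<And>t. 0 \<le> t \<Longrightarrow> z t = z 0 * exp (L t)"
    using complex_log_lift[OF z c nz'] by blast
  have d: "((\<lambda>t. Im (L t)) has_real_derivative
      \<beta> * ((\<eta> t)\<^sup>2 + a t * (\<xi> t)\<^sup>2) / ((\<eta> t)\<^sup>2 + \<beta>\<^sup>2 * (\<xi> t)\<^sup>2)) (at t within {0..})"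
    if "0 \<le> t" for t
    using has_field_derivative_Im[OF L(2)[OF that]]
    by (simp add: Im_divide z_def z'_def power2_eq_square algebra_simps)
  show ?thesis
  proof (rule that[OF L(1) _ d])
    show "continuous_on {0..} (\<lambda>t. Im (L t))" by (rule DERIV_continuous_on[OF d]) auto
  qed (assumption, rule L(3)[unfolded z_def])
qed

text \<open>
  The Sturm comparison behind Zhukovskii's criterion. The angle seen with stretching \<open>b\<close> turns
  at least as fast as \<open>b\<close>, the angle seen with stretching \<open>B\<close> at most as fast as \<open>B\<close>. If the phase
  vectors at times \<open>0\<close> and \<open>\<tau>\<close> were parallel, both angles would have advanced by multiples of
  \<open>\<pi>\<close>, the first by at least \<open>(K + 1)\<pi>\<close> and the second by at most \<open>K\<pi>\<close>. But two stretchings of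
  the same vector always make an acute angle, so the two advances cannot drift apart by \<open>\<pi>\<close>.
\<close>

lemma wronskian_shift_nonzero:
  assumes flow: "hill_flow a \<xi> \<eta>" and cont: "continuous_on {0..} a"
    and lower: "\<And>t. 0 \<le> t \<Longrightarrow> b\<^sup>2 \<le> a t" and upper: "\<And>t. 0 \<le> t \<Longrightarrow> a t \<le> B\<^sup>2"
    and "0 < b" "0 < B" "0 < \<tau>"
    and rot: "real K * pi < b * \<tau>" "B * \<tau> < (real K + 1) * pi"
    and nz: "\<xi> 0 \<noteq> 0 \<or> \<eta> 0 \<noteq> 0"
  shows "\<xi> 0 * \<eta> \<tau> - \<eta> 0 * \<xi> \<tau> \<noteq> 0"
proof
  assume W: "\<xi> 0 * \<eta> \<tau> - \<eta> 0 * \<xi> \<tau> = 0"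
  have bd: "\<bar>a t\<bar> \<le> B\<^sup>2" if "0 \<le> t" for t
    using lower[OF that] upper[OF that] zero_le_power2[of b] by linarith
  have nz': "\<xi> t \<noteq> 0 \<or> \<eta> t \<noteq> 0" if "0 \<le> t" for t
    by (rule hill_flow_nonzero[OF flow bd that nz])
  define z where "z \<beta> t = Complex (\<eta> t) (\<beta> * \<xi> t)" for \<beta> t
  obtain Lb where Lb: "Lb 0 = 0" "continuous_on {0..} (\<lambda>t. Im (Lb t))"
    "\<And>t. 0 \<le> t \<Longrightarrow> ((\<lambda>t. Im (Lb t)) has_real_derivative
        b * ((\<eta> t)\<^sup>2 + a t * (\<xi> t)\<^sup>2) / ((\<eta> t)\<^sup>2 + b\<^sup>2 * (\<xi> t)\<^sup>2)) (at t within {0..})"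
    "\<And>t. 0 \<le> t \<Longrightarrow> z b t = z b 0 * exp (Lb t)"
    using hill_flow_phase[OF flow cont bd \<open>0 < b\<close> nz] unfolding z_def by blast
  obtain LB where LB: "LB 0 = 0" "continuous_on {0..} (\<lambda>t. Im (LB t))"
    "\<And>t. 0 \<le> t \<Longrightarrow> ((\<lambda>t. Im (LB t)) has_real_derivative
        B * ((\<eta> t)\<^sup>2 + a t * (\<xi> t)\<^sup>2) / ((\<eta> t)\<^sup>2 + B\<^sup>2 * (\<xi> t)\<^sup>2)) (at t within {0..})"
    "\<And>t. 0 \<le> t \<Longrightarrow> z B t = z B 0 * exp (LB t)"
    using hill_flow_phase[OF flow cont bd \<open>0 < B\<close> nz] unfolding z_def by blast
  have pos: "0 < (\<eta> t)\<^sup>2 + c * (\<xi> t)\<^sup>2" if "0 < c" "0 \<le> t" for c t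
    using nz'[OF that(2)] that(1)
    by (metis add_pos_nonneg add_nonneg_pos mult_pos_pos mult_nonneg_nonneg less_imp_le
        zero_less_power2 zero_le_power2)
  have "Im (Lb 0) - b * 0 \<le> Im (Lb \<tau>) - b * \<tau>"
  proof (rule mono_if_deriv_nonneg_halfline[where f="\<lambda>t. Im (Lb t) - b * t" and c=0])
    fix t :: real assume t: "0 \<le> t"
    show "((\<lambda>t. Im (Lb t) - b * t) has_real_derivative
       b * ((\<eta> t)\<^sup>2 + a t * (\<xi> t)\<^sup>2) / ((\<eta> t)\<^sup>2 + b\<^sup>2 * (\<xi> t)\<^sup>2) - b) (at t within {0..})"
      by (rule DERIV_diff[OF Lb(3)[OF t]]) (auto intro!: derivative_eq_intros)
    have "b * ((\<eta> t)\<^sup>2 + b\<^sup>2 * (\<xi> t)\<^sup>2) \<le> b * ((\<eta> t)\<^sup>2 + a t * (\<xi> t)\<^sup>2)"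
      using lower[OF t] \<open>0 < b\<close> by (intro mult_left_mono add_left_mono mult_right_mono) auto
    then show "0 \<le> b * ((\<eta> t)\<^sup>2 + a t * (\<xi> t)\<^sup>2) / ((\<eta> t)\<^sup>2 + b\<^sup>2 * (\<xi> t)\<^sup>2) - b"
      using pos[of "b\<^sup>2" t] \<open>0 < b\<close> t by (simp add: pos_le_divide_eq)
  qed (use \<open>0 < \<tau>\<close> in auto)
  then have fast: "b * \<tau> \<le> Im (Lb \<tau>)" using Lb(1) by simp
  have "B * 0 - Im (LB 0) \<le> B * \<tau> - Im (LB \<tau>)"
  proof (rule mono_if_deriv_nonneg_halfline[where f="\<lambda>t. B * t - Im (LB t)" and c=0])
    fix t :: real assume t: "0 \<le> t"
    show "((\<lambda>t. B * t - Im (LB t)) has_real_derivative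
       B - B * ((\<eta> t)\<^sup>2 + a t * (\<xi> t)\<^sup>2) / ((\<eta> t)\<^sup>2 + B\<^sup>2 * (\<xi> t)\<^sup>2)) (at t within {0..})"
      by (rule DERIV_diff[OF _ LB(3)[OF t]]) (auto intro!: derivative_eq_intros)
    have "B * ((\<eta> t)\<^sup>2 + a t * (\<xi> t)\<^sup>2) \<le> B * ((\<eta> t)\<^sup>2 + B\<^sup>2 * (\<xi> t)\<^sup>2)"
      using upper[OF t] \<open>0 < B\<close> by (intro mult_left_mono add_left_mono mult_right_mono) auto
    then show "0 \<le> B - B * ((\<eta> t)\<^sup>2 + a t * (\<xi> t)\<^sup>2) / ((\<eta> t)\<^sup>2 + B\<^sup>2 * (\<xi> t)\<^sup>2)"
      using pos[of "B\<^sup>2" t] \<open>0 < B\<close> t by (simp add: pos_divide_le_eq)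
  qed (use \<open>0 < \<tau>\<close> in auto)
  then have slow: "Im (LB \<tau>) \<le> B * \<tau>" using LB(1) by simp
  have multiple: "\<exists>j::int. Im (L \<tau>) = of_int j * pi"
    if "z \<beta> \<tau> = z \<beta> 0 * exp (L \<tau>)" "0 < \<beta>" for L \<beta>
  proof -
    have "z \<beta> 0 \<noteq> 0" using nz' that(2) by (auto simp: z_def complex_eq_iff)
    have "Im (cnj (z \<beta> 0) * z \<beta> \<tau>) = \<beta> * (\<eta> 0 * \<xi> \<tau> - \<xi> 0 * \<eta> \<tau>)"
      by (simp add: z_def algebra_simps)
    also have "\<dots> = 0" using W by auto
    finally have "Im (cnj (z \<beta> 0) * z \<beta> 0 * exp (L \<tau>)) = 0"
      by (simp add: that(1) mult.assoc)
    then have "Im (of_real ((cmod (z \<beta> 0))\<^sup>2) * exp (L \<tau>)) = 0"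
      by (metis complex_norm_square mult.commute)
    then have "sin (Im (L \<tau>)) = 0"
      using \<open>z \<beta> 0 \<noteq> 0\<close> by (simp add: Im_exp)
    then show ?thesis by (simp add: sin_zero_iff_int2)
  qed
  obtain j where j: "Im (Lb \<tau>) = of_int j * pi" using multiple[where L=Lb and \<beta>=b, OF Lb(4)[of \<tau>]] \<open>0 < b\<close> \<open>0 < \<tau>\<close> by auto
  obtain k where k: "Im (LB \<tau>) = of_int k * pi" using multiple[where L=LB and \<beta>=B, OF LB(4)[of \<tau>]] \<open>0 < B\<close> \<open>0 < \<tau>\<close> by auto
  have "real K * pi < of_int j * pi" using rot(1) fast j by linarith
  then have "of_int (int K) < (of_int j :: real)" by simp
  then have "int K < j" by (simp only: of_int_less_iff)
  moreover have "of_int k * pi < (real K + 1) * pi" using rot(2) slow k by linarith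
  then have "of_int k < (of_int (int K + 1) :: real)" by simp
  then have "k < int K + 1" by (simp only: of_int_less_iff)
  ultimately have "k + 1 \<le> j" by linarith
  then have "of_int k + 1 \<le> (of_int j :: real)" by linarith
  then have "(of_int k + 1) * pi \<le> of_int j * pi" by (rule mult_right_mono) simp
  then have end_le: "Im (LB \<tau>) - Im (Lb \<tau>) \<le> - pi" using j k by (simp add: algebra_simps)
  \<comment> \<open>At this time the vector \<open>z B t / z b t\<close> points opposite to its initial direction, although
    both lie in the right half-plane.\<close>
  obtain t where t: "0 \<le> t" "t \<le> \<tau>" "Im (LB t) - Im (Lb t) = - pi"
  proof -
    have "\<exists>t. 0 \<le> t \<and> t \<le> \<tau> \<and> Im (LB t) - Im (Lb t) = - pi"
    proof (rule IVT2')
      show "continuous_on {0..\<tau>} (\<lambda>t. Im (LB t) - Im (Lb t))"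
        by (rule continuous_on_subset[OF continuous_on_diff[OF LB(2) Lb(2)]]) auto
    qed (use end_le Lb(1) LB(1) \<open>0 < \<tau>\<close> in auto)
    then show ?thesis using that by blast
  qed
  have Re_pos: "0 < Re (z B s * cnj (z b s))" if "0 \<le> s" for s
    using pos[of "b * B" s] \<open>0 < b\<close> \<open>0 < B\<close> that
    by (simp add: z_def power2_eq_square algebra_simps)
  have "z B t * cnj (z b t) = (z B 0 * cnj (z b 0)) * exp (LB t + cnj (Lb t))"
    using Lb(4)[OF t(1)] LB(4)[OF t(1)] by (simp add: exp_add exp_cnj)
  also have "LB t + cnj (Lb t) = Complex (Re (LB t + Lb t)) (- pi)"
    using t(3) by (simp add: complex_eq_iff)
  also have "exp \<dots> = - of_real (exp (Re (LB t + Lb t)))"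
    by (simp add: complex_eq_iff Re_exp Im_exp)
  finally have "Re (z B t * cnj (z b t)) = - (exp (Re (LB t + Lb t)) * Re (z B 0 * cnj (z b 0)))"
    by (simp add: algebra_simps)
  with Re_pos[OF t(1)] Re_pos[of 0] show False
    using mult_pos_pos[OF exp_gt_zero Re_pos[of 0], of "Re (LB t + Lb t)"] by linarith
qed

section \<open>Zhukovskii's stability criterion\<close>

lemma periodic_value_in_first_period:
  fixes f :: "real \<Rightarrow> 'a"
  assumes per: "\<And>t. 0 \<le> t \<Longrightarrow> f (t + \<tau>) = f t" and "0 < \<tau>" "0 \<le> t"
  obtains s where "s \<in> {0..\<tau>}" "f t = f s"
proof -
  have shift: "f (s + real n * \<tau>) = f s" if "0 \<le> s" for s n
  proof (induction n)
    case (Suc n)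
    have "f (s + real (Suc n) * \<tau>) = f (s + real n * \<tau> + \<tau>)" by (simp add: algebra_simps)
    also have "\<dots> = f s" using per[of "s + real n * \<tau>"] Suc that \<open>0 < \<tau>\<close> by simp
    finally show ?case .
  qed simp
  define n where "n = nat \<lfloor>t / \<tau>\<rfloor>"
  have n: "real n = of_int \<lfloor>t / \<tau>\<rfloor>" using assms by (simp add: n_def)
  have "real n \<le> t / \<tau>" "t / \<tau> < real n + 1" unfolding n by linarith+
  then have "real n * \<tau> \<le> t" "t < real n * \<tau> + \<tau>"
    using \<open>0 < \<tau>\<close> by (simp_all add: field_simps)
  then show ?thesis
    using that[of "t - real n * \<tau>"] shift[of "t - real n * \<tau>" n] by auto
qed

text \<open>
  For \<open>\<bar>T\<bar> < 2\<close> the one-step map of the recurrence is conjugate to a rotation: the quadratic form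
  \<open>x\<^sup>2 - T x y + y\<^sup>2\<close> is invariant and positive definite. Along \<open>f\<close> this form is a periodic continuous
  function of time, hence bounded.
\<close>

lemma elliptic_recurrence_bounded:
  fixes f :: "real \<Rightarrow> real"
  assumes cont: "continuous_on {0..} f"
    and rec: "\<And>t. 0 \<le> t \<Longrightarrow> f (t + \<tau> + \<tau>) = T * f (t + \<tau>) - f t"
    and T: "\<bar>T\<bar> < 2" and "0 < \<tau>"
  obtains K where "\<And>t. 0 \<le> t \<Longrightarrow> \<bar>f t\<bar> \<le> K"
proof -
  define Q where "Q t = (f t)\<^sup>2 - T * f t * f (t + \<tau>) + (f (t + \<tau>))\<^sup>2" for t
  have per: "Q (t + \<tau>) = Q t" if "0 \<le> t" for t
    unfolding Q_def rec[OF that] by (simp add: power2_eq_square algebra_simps)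
  have "continuous_on {0..\<tau>} (\<lambda>t. f (t + \<tau>))"
    by (rule continuous_on_compose2[OF cont]) (use \<open>0 < \<tau>\<close> in \<open>auto intro!: continuous_intros\<close>)
  moreover have "continuous_on {0..\<tau>} f" using cont by (rule continuous_on_subset) auto
  ultimately have "continuous_on {0..\<tau>} Q"
    unfolding Q_def by (intro continuous_intros)
  then have "bounded (Q ` {0..\<tau>})"
    by (intro compact_imp_bounded compact_continuous_image) auto
  then obtain C where C: "\<And>s. s \<in> {0..\<tau>} \<Longrightarrow> \<bar>Q s\<bar> \<le> C"
    unfolding bounded_iff by (metis image_eqI real_norm_def)
  have "\<bar>f t\<bar> \<le> 1 + C / (1 - \<bar>T\<bar> / 2)" if t: "0 \<le> t" for t
  proof -
    obtain s where "s \<in> {0..\<tau>}" "Q t = Q s"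
      using periodic_value_in_first_period[of Q, OF per \<open>0 < \<tau>\<close> t] by blast
    then have "Q t \<le> C" using C[of s] by auto
    have "T * f t * f (t + \<tau>) \<le> \<bar>T\<bar> / 2 * (2 * \<bar>f t\<bar> * \<bar>f (t + \<tau>)\<bar>)"
      using abs_ge_self[of "T * f t * f (t + \<tau>)"] by (simp add: abs_mult)
    also have "\<dots> \<le> \<bar>T\<bar> / 2 * ((f t)\<^sup>2 + (f (t + \<tau>))\<^sup>2)"
      using sum_squares_bound[of "\<bar>f t\<bar>" "\<bar>f (t + \<tau>)\<bar>"] by (intro mult_left_mono) auto
    finally have "(1 - \<bar>T\<bar> / 2) * ((f t)\<^sup>2 + (f (t + \<tau>))\<^sup>2) \<le> Q t"
      unfolding Q_def by (simp add: algebra_simps)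
    moreover have "(1 - \<bar>T\<bar> / 2) * (f t)\<^sup>2 \<le> (1 - \<bar>T\<bar> / 2) * ((f t)\<^sup>2 + (f (t + \<tau>))\<^sup>2)"
      using T by (intro mult_left_mono) auto
    ultimately have "(1 - \<bar>T\<bar> / 2) * (f t)\<^sup>2 \<le> C" using \<open>Q t \<le> C\<close> by linarith
    then have "(f t)\<^sup>2 \<le> C / (1 - \<bar>T\<bar> / 2)" using T by (simp add: pos_le_divide_eq mult.commute)
    moreover have "\<bar>f t\<bar> \<le> 1 + (f t)\<^sup>2"
      using sum_squares_bound[of 1 "\<bar>f t\<bar>"] by simp
    ultimately show ?thesis by linarith
  qed
  then show ?thesis by (rule that)
qed

text \<open>
  A nonzero solution \<open>u\<close> and its shift by one period form a fundamental system, because their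
  Wronskian \<open>w\<close> is not zero; fundamental solutions thus come for free from a single one. Since the
  Wronskian is preserved, \<open>u(t + 2\<tau>) = T u(t + \<tau>) - u(t)\<close>, where \<open>T\<close> is the trace of the monodromy
  matrix. If \<open>\<bar>T\<bar> \<ge> 2\<close>, a real Floquet multiplier \<open>\<mu>\<close> would give a nonzero solution proportional to
  its shift, which \<open>wronskian_shift_nonzero\<close> excludes. Hence \<open>u\<close> and its velocity are bounded, and
  so are all solutions, uniformly in the initial data by Cramer's rule.
\<close>

theorem zhukovskii_bounded:
  assumes cont: "continuous_on {0..} a" and per: "\<And>t. 0 \<le> t \<Longrightarrow> a (t + \<tau>) = a t"
    and lower: "\<And>t. 0 \<le> t \<Longrightarrow> b\<^sup>2 \<le> a t" and upper: "\<And>t. 0 \<le> t \<Longrightarrow> a t \<le> B\<^sup>2"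
    and pos: "0 < b" "0 < B" "0 < \<tau>"
    and rot: "real K * pi < b * \<tau>" "B * \<tau> < (real K + 1) * pi"
  obtains C where "0 < C"
    "\<And>\<xi> \<eta> t. hill_flow a \<xi> \<eta> \<Longrightarrow> 0 \<le> t \<Longrightarrow>
       \<bar>\<xi> t\<bar> \<le> C * (\<bar>\<xi> 0\<bar> + \<bar>\<eta> 0\<bar>) \<and> \<bar>\<eta> t\<bar> \<le> C * (\<bar>\<xi> 0\<bar> + \<bar>\<eta> 0\<bar>)"
proof -
  have bd: "\<bar>a t\<bar> \<le> B\<^sup>2" if "0 \<le> t" for t
    using lower[OF that] upper[OF that] zero_le_power2[of b] by linarith
  show ?thesis
  proof (cases "\<exists>u v. hill_flow a u v \<and> (u 0 \<noteq> 0 \<or> v 0 \<noteq> 0)")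
    case False
    have "\<bar>\<xi> t\<bar> \<le> 1 * (\<bar>\<xi> 0\<bar> + \<bar>\<eta> 0\<bar>) \<and> \<bar>\<eta> t\<bar> \<le> 1 * (\<bar>\<xi> 0\<bar> + \<bar>\<eta> 0\<bar>)"
      if "hill_flow a \<xi> \<eta>" "0 \<le> t" for \<xi> \<eta> t
      using hill_flow_unique[of a \<xi> \<eta> \<xi> \<eta> "B\<^sup>2" 0 0 \<xi> \<eta> t] that bd False by force
    then show ?thesis using that[of 1] by simp
  next
    case True
    then obtain u v where uv: "hill_flow a u v" and nz: "u 0 \<noteq> 0 \<or> v 0 \<noteq> 0" by blast
    note shift = hill_flow_shift[where a=a and \<tau>=\<tau>, OF _ per less_imp_le[OF pos(3)]]
    note uv1 = shift[OF uv]
    note uv2 = shift[OF uv1]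
    define w where "w = u 0 * v \<tau> - v 0 * u \<tau>"
    have w: "w \<noteq> 0"
      unfolding w_def by (rule wronskian_shift_nonzero[OF uv cont lower upper pos rot nz])
    have w1: "u \<tau> * v (\<tau> + \<tau>) - v \<tau> * u (\<tau> + \<tau>) = w"
      using wronskian_constant[OF uv uv1, of \<tau>] pos by (simp add: w_def)
    define T where "T = (u 0 * v (\<tau> + \<tau>) - v 0 * u (\<tau> + \<tau>)) / w"
    then have wT: "u 0 * v (\<tau> + \<tau>) - v 0 * u (\<tau> + \<tau>) = w * T" using w by simp
    \<comment> \<open>Coordinates of the twice shifted data in the basis of the data at \<open>0\<close> and \<open>\<tau>\<close>: the
      coefficient of the data at \<open>0\<close> is \<open>-1\<close> because the Wronskian at \<open>\<tau>\<close> is again \<open>w\<close>.\<close>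
    have "w * u (\<tau> + \<tau>) = w * (T * u \<tau> + (-1) * u 0)"
    proof -
      have "w * u (\<tau> + \<tau>) = (u 0 * v (\<tau> + \<tau>) - v 0 * u (\<tau> + \<tau>)) * u \<tau>
          - (u \<tau> * v (\<tau> + \<tau>) - v \<tau> * u (\<tau> + \<tau>)) * u 0"
        by (simp add: w_def algebra_simps)
      then show ?thesis unfolding w1 wT by (simp add: algebra_simps)
    qed
    moreover have "w * v (\<tau> + \<tau>) = w * (T * v \<tau> + (-1) * v 0)"
    proof -
      have "w * v (\<tau> + \<tau>) = (u 0 * v (\<tau> + \<tau>) - v 0 * u (\<tau> + \<tau>)) * v \<tau>
          - (u \<tau> * v (\<tau> + \<tau>) - v \<tau> * u (\<tau> + \<tau>)) * v 0"
        by (simp add: w_def algebra_simps)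
      then show ?thesis unfolding w1 wT by (simp add: algebra_simps)
    qed
    ultimately have data2: "u (\<tau> + \<tau>) = T * u \<tau> + (-1) * u 0"
        "v (\<tau> + \<tau>) = T * v \<tau> + (-1) * v 0"
      using w by (simp_all only: mult_left_cancel[OF w])
    have rec: "u (t + \<tau> + \<tau>) = T * u (t + \<tau>) - u t" "v (t + \<tau> + \<tau>) = T * v (t + \<tau>) - v t"
      if "0 \<le> t" for t
      using hill_flow_unique[OF uv2 uv1 bd _ _ uv that, of T "-1"] data2 by auto
    have T: "\<bar>T\<bar> < 2"
    proof (rule ccontr)
      assume "\<not> \<bar>T\<bar> < 2"
      then have "2\<^sup>2 \<le> \<bar>T\<bar>\<^sup>2" by (intro power_mono) auto
      then have disc: "0 \<le> T\<^sup>2 - 4" by simp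
      \<comment> \<open>A real Floquet multiplier, the other one being its inverse.\<close>
      define \<mu> where "\<mu> = (T + sqrt (T\<^sup>2 - 4)) / 2"
      have \<mu>: "\<mu>\<^sup>2 = T * \<mu> - 1"
      proof -
        have "2 * \<mu> - T = sqrt (T\<^sup>2 - 4)" by (simp add: \<mu>_def field_simps)
        then have "(2 * \<mu> - T)\<^sup>2 = T\<^sup>2 - 4" using disc by simp
        then show ?thesis by (simp add: power2_eq_square algebra_simps)
      qed
      have flow: "hill_flow a (\<lambda>t. 1 * u (t + \<tau>) + (- \<mu>) * u t) (\<lambda>t. 1 * v (t + \<tau>) + (- \<mu>) * v t)"
        by (rule hill_flow_lincomb[OF uv1 uv])
      have "1 * u (0 + \<tau>) + (- \<mu>) * u 0 \<noteq> 0 \<or> 1 * v (0 + \<tau>) + (- \<mu>) * v 0 \<noteq> 0"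
      proof (rule ccontr)
        assume "\<not> ?thesis"
        then have "u \<tau> = \<mu> * u 0" "v \<tau> = \<mu> * v 0" by auto
        then show False using w by (simp add: w_def)
      qed
      from wronskian_shift_nonzero[OF flow cont lower upper pos rot this]
      have "(u \<tau> - \<mu> * u 0) * (v (\<tau> + \<tau>) - \<mu> * v \<tau>) \<noteq> (v \<tau> - \<mu> * v 0) * (u (\<tau> + \<tau>) - \<mu> * u \<tau>)"
        by simp
      moreover have "(u \<tau> - \<mu> * u 0) * (v (\<tau> + \<tau>) - \<mu> * v \<tau>)
            - (v \<tau> - \<mu> * v 0) * (u (\<tau> + \<tau>) - \<mu> * u \<tau>) = (1 + \<mu>\<^sup>2 - T * \<mu>) * w"
        unfolding data2 w_def by (simp add: power2_eq_square algebra_simps)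
      ultimately show False using \<mu> by simp
    qed
    obtain Ku where Ku: "\<And>t. 0 \<le> t \<Longrightarrow> \<bar>u t\<bar> \<le> Ku"
      using elliptic_recurrence_bounded[OF hill_flow_continuous(1)[OF uv] rec(1) T pos(3)] by blast
    obtain Kv where Kv: "\<And>t. 0 \<le> t \<Longrightarrow> \<bar>v t\<bar> \<le> Kv"
      using elliptic_recurrence_bounded[OF hill_flow_continuous(2)[OF uv] rec(2) T pos(3)] by blast
    define k where "k = Ku + Kv"
    have k: "0 \<le> k" "\<And>t. 0 \<le> t \<Longrightarrow> \<bar>u t\<bar> \<le> k" "\<And>t. 0 \<le> t \<Longrightarrow> \<bar>v t\<bar> \<le> k"
      using Ku Kv Ku[of 0] Kv[of 0] unfolding k_def by force+
    define C where "C = 2 * k * k / \<bar>w\<bar> + 1"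
    have "0 < C" using k(1) by (simp add: C_def add_nonneg_pos)
    moreover have "\<bar>\<xi> t\<bar> \<le> C * (\<bar>\<xi> 0\<bar> + \<bar>\<eta> 0\<bar>) \<and> \<bar>\<eta> t\<bar> \<le> C * (\<bar>\<xi> 0\<bar> + \<bar>\<eta> 0\<bar>)"
      if flow: "hill_flow a \<xi> \<eta>" and t: "0 \<le> t" for \<xi> \<eta> t
    proof -
      define n where "n = \<bar>\<xi> 0\<bar> + \<bar>\<eta> 0\<bar>"
      \<comment> \<open>Coordinates of the initial data in the basis \<open>(u 0, v 0)\<close>, \<open>(u \<tau>, v \<tau>)\<close>.\<close>
      define p q where "p = (\<xi> 0 * v \<tau> - \<eta> 0 * u \<tau>) / w" and "q = (u 0 * \<eta> 0 - v 0 * \<xi> 0) / w"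
      then have wp: "w * p = \<xi> 0 * v \<tau> - \<eta> 0 * u \<tau>" and wq: "w * q = u 0 * \<eta> 0 - v 0 * \<xi> 0"
        using w by simp_all
      have "w * \<xi> 0 = w * (p * u 0 + q * u (0 + \<tau>))" "w * \<eta> 0 = w * (p * v 0 + q * v (0 + \<tau>))"
        by (simp_all only: ring_distribs mult.assoc[symmetric] wp wq)
          (simp_all add: w_def algebra_simps)
      then have "\<xi> 0 = p * u 0 + q * u (0 + \<tau>)" "\<eta> 0 = p * v 0 + q * v (0 + \<tau>)"
        by (simp_all only: mult_left_cancel[OF w])
      from hill_flow_unique[OF flow uv bd this uv1 t]
      have eq: "\<xi> t = p * u t + q * u (t + \<tau>)" "\<eta> t = p * v t + q * v (t + \<tau>)" by auto
      have cramer: "\<bar>(x * \<alpha> - y * \<beta>) / w\<bar> \<le> k * n / \<bar>w\<bar>"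
        if "\<bar>\<alpha>\<bar> \<le> k" "\<bar>\<beta>\<bar> \<le> k" "\<bar>x\<bar> + \<bar>y\<bar> = n" for x y \<alpha> \<beta>
      proof -
        have "\<bar>x * \<alpha> - y * \<beta>\<bar> \<le> \<bar>x\<bar> * \<bar>\<alpha>\<bar> + \<bar>y\<bar> * \<bar>\<beta>\<bar>"
          using abs_triangle_ineq4[of "x * \<alpha>" "y * \<beta>"] by (simp add: abs_mult)
        also have "\<dots> \<le> \<bar>x\<bar> * k + \<bar>y\<bar> * k"
          using that by (intro add_mono mult_left_mono) auto
        also have "\<dots> = k * n" using that by (simp add: algebra_simps flip: that(3))
        finally show ?thesis by (simp add: divide_right_mono)
      qed
      have p: "\<bar>p\<bar> \<le> k * n / \<bar>w\<bar>"
        unfolding p_def by (rule cramer) (use k pos in \<open>auto simp: n_def\<close>)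
      have q: "\<bar>q\<bar> \<le> k * n / \<bar>w\<bar>"
        using cramer[of "u 0" "v 0" "\<eta> 0" "\<xi> 0"] k(2,3)[of 0]
        by (simp add: q_def n_def mult.commute add.commute)
      have bound: "\<bar>p * x + q * y\<bar> \<le> C * n" if "\<bar>x\<bar> \<le> k" "\<bar>y\<bar> \<le> k" for x y
      proof -
        have "\<bar>p * x + q * y\<bar> \<le> \<bar>p\<bar> * \<bar>x\<bar> + \<bar>q\<bar> * \<bar>y\<bar>"
          using abs_triangle_ineq[of "p * x" "q * y"] by (simp add: abs_mult)
        also have "\<dots> \<le> k * n / \<bar>w\<bar> * k + k * n / \<bar>w\<bar> * k"
          using that p q k(1) by (intro add_mono mult_mono) (auto simp: n_def)
        also have "\<dots> \<le> C * n" by (simp add: C_def n_def algebra_simps)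
        finally show ?thesis .
      qed
      show ?thesis
        unfolding eq using bound[of "u t" "u (t + \<tau>)"] bound[of "v t" "v (t + \<tau>)"] k t pos
        by (simp add: n_def)
    qed
    ultimately show ?thesis by (rule that)
  qed
qed

lemma hill_zero_stable_if_bounded:
  assumes "0 < C"
    and "\<And>\<xi> \<eta> t. hill_flow a \<xi> \<eta> \<Longrightarrow> 0 \<le> t \<Longrightarrow>
       \<bar>\<xi> t\<bar> \<le> C * (\<bar>\<xi> 0\<bar> + \<bar>\<eta> 0\<bar>) \<and> \<bar>\<eta> t\<bar> \<le> C * (\<bar>\<xi> 0\<bar> + \<bar>\<eta> 0\<bar>)"
  shows "hill_zero_stable a"
  unfolding hill_zero_stable_def
proof (intro allI impI)
  fix \<epsilon> :: real assume "0 < \<epsilon>"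
  have "\<bar>\<xi> t\<bar> < \<epsilon> \<and> \<bar>deriv_on {0..} \<xi> t\<bar> < \<epsilon>"
    if sol: "hill_solution a \<xi>" and "\<bar>\<xi> 0\<bar> < \<epsilon> / (2 * C)" "\<bar>deriv_on {0..} \<xi> 0\<bar> < \<epsilon> / (2 * C)"
      and t: "0 \<le> t" for \<xi> t
  proof -
    have "hill_flow a \<xi> (deriv_on {0..} \<xi>)"
      unfolding hill_flow_def
    proof (intro allI impI conjI)
      fix s :: real assume s: "0 \<le> s"
      have C2: "C2_halfline \<xi>" and eq: "deriv_on {0..} (deriv_on {0..} \<xi>) s = - a s * \<xi> s"
        using sol s by (auto simp: hill_solution_def add_eq_0_iff)
      show "(\<xi> has_real_derivative deriv_on {0..} \<xi> s) (at s within {0..})"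
        by (rule C2_halfline_derivs(1)[OF C2 s])
      show "(deriv_on {0..} \<xi> has_real_derivative - a s * \<xi> s) (at s within {0..})"
        using C2_halfline_derivs(2)[OF C2 s] unfolding eq .
    qed
    moreover have "C * (\<bar>\<xi> 0\<bar> + \<bar>deriv_on {0..} \<xi> 0\<bar>) < C * (\<epsilon> / (2 * C) + \<epsilon> / (2 * C))"
      using that \<open>0 < C\<close> by (intro mult_strict_left_mono add_strict_mono) auto
    moreover have "C * (\<epsilon> / (2 * C) + \<epsilon> / (2 * C)) = \<epsilon>" using \<open>0 < C\<close> by (simp add: field_simps)
    ultimately show ?thesis using assms(2)[of \<xi> "deriv_on {0..} \<xi>" t] t by linarith
  qed
  then show "\<exists>\<eta>>0. \<forall>\<xi>. hill_solution a \<xi> \<longrightarrow> \<bar>\<xi> 0\<bar> < \<eta> \<longrightarrow> \<bar>deriv_on {0..} \<xi> 0\<bar> < \<eta> \<longrightarrow>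
        (\<forall>t\<ge>0. \<bar>\<xi> t\<bar> < \<epsilon> \<and> \<bar>deriv_on {0..} \<xi> t\<bar> < \<epsilon>)"
    using \<open>0 < \<epsilon>\<close> \<open>0 < C\<close> by (intro exI[of _ "\<epsilon> / (2 * C)"]) auto
qed

corollary zhukovskii_zero_stable:
  assumes "continuous_on {0..} a" "\<And>t. 0 \<le> t \<Longrightarrow> a (t + \<tau>) = a t"
    and "\<And>t. 0 \<le> t \<Longrightarrow> b\<^sup>2 \<le> a t" "\<And>t. 0 \<le> t \<Longrightarrow> a t \<le> B\<^sup>2"
    and "0 < b" "0 < B" "0 < \<tau>"
    and "real K * pi < b * \<tau>" "B * \<tau> < (real K + 1) * pi"
  shows "hill_zero_stable a"
proof (rule zhukovskii_bounded[of a \<tau> b B K])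
  show "hill_zero_stable a" if "0 < C"
    "\<And>\<xi> \<eta> t. hill_flow a \<xi> \<eta> \<Longrightarrow> 0 \<le> t \<Longrightarrow>
       \<bar>\<xi> t\<bar> \<le> C * (\<bar>\<xi> 0\<bar> + \<bar>\<eta> 0\<bar>) \<and> \<bar>\<eta> t\<bar> \<le> C * (\<bar>\<xi> 0\<bar> + \<bar>\<eta> 0\<bar>)" for C
    using that by (rule hill_zero_stable_if_bounded)
qed (fact assms)+


section \<open>The Duffing oscillator\<close>

text \<open>
  With \<open>\<phi> = A sin \<theta>\<close>, conservation of energy becomes \<open>\<theta>' = duffing_speed \<omega> \<kappa> A \<theta>\<close>, and the half
  period is the time in which \<open>\<theta>\<close> advances by \<open>\<pi>\<close>.
\<close>

definition duffing_speed :: "real \<Rightarrow> real \<Rightarrow> real \<Rightarrow> real \<Rightarrow> real" where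
  "duffing_speed \<omega> \<kappa> A \<theta> = sqrt (\<omega>\<^sup>2 + \<kappa> / 2 * (A\<^sup>2 * (1 + (sin \<theta>)\<^sup>2)))"

definition duffing_half_period :: "real \<Rightarrow> real \<Rightarrow> real \<Rightarrow> real" where
  "duffing_half_period \<omega> \<kappa> A = integral {0..pi} (\<lambda>\<theta>. 1 / duffing_speed \<omega> \<kappa> A \<theta>)"

lemma duffing_speed_bounds:
  assumes "0 < \<omega>" "0 < \<kappa>"
  shows "\<omega> \<le> duffing_speed \<omega> \<kappa> A \<theta>" "duffing_speed \<omega> \<kappa> A \<theta> \<le> sqrt (\<omega>\<^sup>2 + \<kappa> * A\<^sup>2)"
    "0 < duffing_speed \<omega> \<kappa> A \<theta>"
proof -
  have "0 \<le> \<kappa> / 2 * (A\<^sup>2 * (1 + (sin \<theta>)\<^sup>2))" using assms by simp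
  then show "\<omega> \<le> duffing_speed \<omega> \<kappa> A \<theta>"
    unfolding duffing_speed_def by (intro real_le_rsqrt) auto
  then show "0 < duffing_speed \<omega> \<kappa> A \<theta>" using assms by linarith
  have "\<kappa> / 2 * (A\<^sup>2 * (1 + (sin \<theta>)\<^sup>2)) \<le> \<kappa> / 2 * (A\<^sup>2 * 2)"
    using assms by (intro mult_left_mono) (auto simp: abs_square_le_1)
  then show "duffing_speed \<omega> \<kappa> A \<theta> \<le> sqrt (\<omega>\<^sup>2 + \<kappa> * A\<^sup>2)"
    unfolding duffing_speed_def by simp
qed

lemma continuous_on_inverse_duffing_speed:
  assumes "0 < \<omega>" "0 < \<kappa>"
  shows "continuous_on S (\<lambda>\<theta>. 1 / duffing_speed \<omega> \<kappa> A \<theta>)"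
proof -
  have "continuous_on S (duffing_speed \<omega> \<kappa> A)"
    unfolding duffing_speed_def by (intro continuous_intros)
  then show ?thesis
    using duffing_speed_bounds(3)[OF assms] by (intro continuous_intros) (auto simp: less_imp_neq[symmetric])
qed

lemma duffing_half_period_bounds:
  assumes "0 < \<omega>" "0 < \<kappa>"
  shows "pi / sqrt (\<omega>\<^sup>2 + \<kappa> * A\<^sup>2) \<le> duffing_half_period \<omega> \<kappa> A"
    and "duffing_half_period \<omega> \<kappa> A \<le> pi / \<omega>"
proof -
  note b = duffing_speed_bounds[OF assms, of A]
  have int: "(\<lambda>\<theta>. 1 / duffing_speed \<omega> \<kappa> A \<theta>) integrable_on {0..pi}"
    by (intro integrable_continuous_real continuous_on_inverse_duffing_speed assms)
  have s: "0 < sqrt (\<omega>\<^sup>2 + \<kappa> * A\<^sup>2)" using b(2,3)[of 0] by linarith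
  have "integral {0..pi} (\<lambda>\<theta>. 1 / sqrt (\<omega>\<^sup>2 + \<kappa> * A\<^sup>2)) \<le> duffing_half_period \<omega> \<kappa> A"
    unfolding duffing_half_period_def
    by (intro integral_le int integrable_const_ivl frac_le) (use b s in auto)
  then show "pi / sqrt (\<omega>\<^sup>2 + \<kappa> * A\<^sup>2) \<le> duffing_half_period \<omega> \<kappa> A" by simp
  have "duffing_half_period \<omega> \<kappa> A \<le> integral {0..pi} (\<lambda>\<theta>. 1 / \<omega>)"
    unfolding duffing_half_period_def
    by (intro integral_le int integrable_const_ivl frac_le) (use b assms in auto)
  then show "duffing_half_period \<omega> \<kappa> A \<le> pi / \<omega>" by simp
qed

text \<open>
  The Taylor polynomial of order two has coefficient \<open>3/8\<close> at \<open>y\<^sup>2\<close>; the larger coefficient \<open>1\<close>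
  absorbs the cubic term, which is positive for negative \<open>y\<close>.
\<close>

lemma inverse_sqrt_upper:
  fixes y :: real
  assumes "\<bar>y\<bar> \<le> 1 / 2"
  shows "1 / sqrt (1 + y) \<le> 1 - y / 2 + y\<^sup>2"
proof -
  have p: "0 < 1 - y / 2 + y\<^sup>2" using assms zero_le_power2[of y] by linarith
  have "\<bar>y\<bar>^3 \<le> (1/2)^3" using assms by (intro power_mono) auto
  then have "\<bar>y^3\<bar> \<le> 1/8" by (simp add: power_abs power_divide)
  then have "0 \<le> 5 / 4 + 5 / 4 * y + y^3" using assms by linarith
  then have "0 \<le> y\<^sup>2 * (5 / 4 + 5 / 4 * y + y^3)" by simp
  also have "y\<^sup>2 * (5 / 4 + 5 / 4 * y + y^3) = (1 - y / 2 + y\<^sup>2)\<^sup>2 * (1 + y) - 1"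
    by (simp add: power2_eq_square power3_eq_cube algebra_simps)
  finally have "1 \<le> (1 - y / 2 + y\<^sup>2)\<^sup>2 * (1 + y)" by simp
  then have "sqrt 1 \<le> sqrt ((1 - y / 2 + y\<^sup>2)\<^sup>2 * (1 + y))" by (rule real_sqrt_le_mono)
  then have "1 \<le> (1 - y / 2 + y\<^sup>2) * sqrt (1 + y)" using p by (simp add: real_sqrt_mult)
  then show ?thesis using assms by (simp add: pos_divide_le_eq)
qed

lemma has_integral_1_plus_sin_squared: "((\<lambda>\<theta>. 1 + (sin \<theta>)\<^sup>2) has_integral (3 * pi / 2)) {0..pi}"
proof -
  have "((\<lambda>\<theta>. 1 + (sin \<theta>)\<^sup>2) has_integral
     ((3 * pi / 2 - sin pi * cos pi / 2) - (3 * 0 / 2 - sin 0 * cos 0 / 2))) {0..pi}"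
  proof (rule fundamental_theorem_of_calculus)
    fix x :: real
    have "((\<lambda>\<theta>. 3 * \<theta> / 2 - sin \<theta> * cos \<theta> / 2) has_real_derivative
        3 / 2 - (cos x * cos x - sin x * sin x) / 2) (at x within {0..pi})"
      by (auto intro!: derivative_eq_intros)
    moreover have "3 / 2 - (cos x * cos x - sin x * sin x) / 2 = 1 + (sin x)\<^sup>2"
      using sin_cos_squared_add[of x] by (simp add: power2_eq_square field_simps)
    ultimately show "((\<lambda>\<theta>. 3 * \<theta> / 2 - sin \<theta> * cos \<theta> / 2) has_vector_derivative 1 + (sin x)\<^sup>2)
        (at x within {0..pi})"
      by (simp add: has_real_derivative_iff_has_vector_derivative)
  qed simp
  then show ?thesis by simp
qed

text \<open>
  Under the root of \<open>duffing_speed\<close>, the term \<open>\<kappa>/2 A\<^sup>2 (1 + sin\<^sup>2 \<theta>)\<close> has mean \<open>3/4 \<kappa> A\<^sup>2\<close>, which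
  exceeds \<open>\<rho> A\<^sup>2\<close>. So the radicand is \<open>h (1 + y)\<close> with \<open>h = \<omega>\<^sup>2 + \<rho> A\<^sup>2\<close> and \<open>y\<close> of size \<open>O(A\<^sup>2)\<close>
  and positive mean of order \<open>A\<^sup>2\<close>, and in the mean of \<open>1 / \<surd>(1 + y) \<le> 1 - y/2 + y\<^sup>2\<close> the linear term wins for small \<open>A\<close>.
\<close>

lemma duffing_half_period_less:
  assumes "0 < \<omega>" "0 < \<kappa>" "0 < A" and \<rho>: "0 \<le> \<rho>" "4 * \<rho> < 3 * \<kappa>"
    and small: "\<kappa>\<^sup>2 * A\<^sup>2 < (3 * \<kappa> / 8 - \<rho> / 2) * \<omega>\<^sup>2"
  shows "duffing_half_period \<omega> \<kappa> A < pi / sqrt (\<omega>\<^sup>2 + \<rho> * A\<^sup>2)"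
proof -
  define h where "h = \<omega>\<^sup>2 + \<rho> * A\<^sup>2"
  define e where "e = A\<^sup>2 / h"
  have h: "0 < h" "\<omega>\<^sup>2 \<le> h" using assms by (auto simp: h_def intro: add_pos_nonneg)
  have e: "0 < e" using h assms by (simp add: e_def)
  have "(3 * \<kappa> / 8 - \<rho> / 2) * \<omega>\<^sup>2 \<le> (3 * \<kappa> / 8 - \<rho> / 2) * h"
    using \<rho> h by (intro mult_left_mono) auto
  with small have "\<kappa>\<^sup>2 * A\<^sup>2 < (3 * \<kappa> / 8 - \<rho> / 2) * h" by linarith
  then have small': "\<kappa>\<^sup>2 * e < 3 * \<kappa> / 8 - \<rho> / 2"
    using h by (simp add: e_def pos_divide_less_eq)
  have "\<kappa> * (\<kappa> * e) = \<kappa>\<^sup>2 * e" by (simp add: power2_eq_square)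
  then have "\<kappa> * (\<kappa> * e) < \<kappa> * (1 / 2)"
    using small' \<rho> \<open>0 < \<kappa>\<close> by linarith
  then have small2: "\<kappa> * e < 1 / 2" using \<open>0 < \<kappa>\<close> by (simp only: mult_less_cancel_left_pos)
  define I where "I \<theta> = (1 + (\<kappa> * e)\<^sup>2 + \<rho> * e / 2) - \<kappa> * e / 4 * (1 + (sin \<theta>)\<^sup>2)" for \<theta>
  have I: "(I has_integral ((1 + (\<kappa> * e)\<^sup>2 + \<rho> * e / 2) * pi - \<kappa> * e / 4 * (3 * pi / 2))) {0..pi}"
    unfolding I_def
    using has_integral_diff[OF has_integral_const_real[of "1 + (\<kappa> * e)\<^sup>2 + \<rho> * e / 2" 0 pi]
        has_integral_mult_right[OF has_integral_1_plus_sin_squared, of "\<kappa> * e / 4"]]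
    by (simp add: mult.commute)
  have le: "1 / duffing_speed \<omega> \<kappa> A \<theta> \<le> 1 / sqrt h * I \<theta>" for \<theta>
  proof -
    define y where "y = \<kappa> / 2 * e * (1 + (sin \<theta>)\<^sup>2) - \<rho> * e"
    have s: "(sin \<theta>)\<^sup>2 \<le> 1" by (simp add: abs_square_le_1)
    have "\<kappa> / 2 * e * (1 + (sin \<theta>)\<^sup>2) \<le> \<kappa> / 2 * e * 2"
      using s e \<open>0 < \<kappa>\<close> by (intro mult_left_mono) auto
    moreover have "0 \<le> \<kappa> / 2 * e * (1 + (sin \<theta>)\<^sup>2)" using e \<open>0 < \<kappa>\<close> by simp
    moreover have "\<rho> * e \<le> \<kappa> * e" "0 \<le> \<rho> * e" using \<rho> \<open>0 < \<kappa>\<close> e by auto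
    ultimately have y: "\<bar>y\<bar> \<le> \<kappa> * e" unfolding y_def by linarith
    then have y2: "y\<^sup>2 \<le> (\<kappa> * e)\<^sup>2" by (metis abs_ge_zero power2_abs power_mono)
    have "\<omega>\<^sup>2 + \<kappa> / 2 * (A\<^sup>2 * (1 + (sin \<theta>)\<^sup>2)) = h * (1 + y)"
      using h(1) by (simp add: y_def e_def field_simps) (simp add: h_def algebra_simps)
    then have "1 / duffing_speed \<omega> \<kappa> A \<theta> = 1 / sqrt h * (1 / sqrt (1 + y))"
      unfolding duffing_speed_def by (simp add: real_sqrt_mult)
    also have "\<dots> \<le> 1 / sqrt h * (1 - y / 2 + y\<^sup>2)"
      using y small2 h by (intro mult_left_mono inverse_sqrt_upper) auto
    also have "\<dots> \<le> 1 / sqrt h * I \<theta>"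
    proof -
      have "I \<theta> = 1 - y / 2 + (\<kappa> * e)\<^sup>2" unfolding I_def y_def by (simp add: field_simps)
      then have "1 - y / 2 + y\<^sup>2 \<le> I \<theta>" using y2 by simp
      then show ?thesis using h by (intro mult_left_mono) auto
    qed
    finally show ?thesis .
  qed
  have "duffing_half_period \<omega> \<kappa> A \<le> integral {0..pi} (\<lambda>\<theta>. 1 / sqrt h * I \<theta>)"
    unfolding duffing_half_period_def
    by (intro integral_le integrable_continuous_real continuous_on_inverse_duffing_speed assms le)
       (use h in \<open>auto simp: I_def intro!: continuous_intros\<close>)
  also have "\<dots> = 1 / sqrt h * ((1 + (\<kappa> * e)\<^sup>2 + \<rho> * e / 2) * pi - \<kappa> * e / 4 * (3 * pi / 2))"
    using has_integral_mult_right[OF I, of "1 / sqrt h"] by (rule integral_unique)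
  also have "\<dots> = pi / sqrt h * (1 - e * (3 * \<kappa> / 8 - \<rho> / 2 - \<kappa>\<^sup>2 * e))"
    by (simp add: power2_eq_square algebra_simps)
  also have "\<dots> < pi / sqrt h * 1"
    using e small' h by (intro mult_strict_left_mono) auto
  finally show ?thesis by (simp add: h_def)
qed

lemma duffing_energy_conserved:
  assumes \<phi>: "\<And>t. 0 \<le> t \<Longrightarrow> (\<phi> has_real_derivative \<psi> t) (at t within {0..})"
    and \<psi>: "\<And>t. 0 \<le> t \<Longrightarrow> (\<psi> has_real_derivative - (\<omega>\<^sup>2 * \<phi> t + \<kappa> * (\<phi> t)^3)) (at t within {0..})"
    and t: "0 \<le> t"
  shows "(\<psi> t)\<^sup>2 / 2 + \<omega>\<^sup>2 * (\<phi> t)\<^sup>2 / 2 + \<kappa> * (\<phi> t)^4 / 4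
       = (\<psi> 0)\<^sup>2 / 2 + \<omega>\<^sup>2 * (\<phi> 0)\<^sup>2 / 2 + \<kappa> * (\<phi> 0)^4 / 4"
proof (rule constant_if_deriv_0_halfline[where c=0 and
      f="\<lambda>t. (\<psi> t)\<^sup>2 / 2 + \<omega>\<^sup>2 * (\<phi> t)\<^sup>2 / 2 + \<kappa> * (\<phi> t)^4 / 4"])
  fix s :: real assume "0 \<le> s"
  then show "((\<lambda>t. (\<psi> t)\<^sup>2 / 2 + \<omega>\<^sup>2 * (\<phi> t)\<^sup>2 / 2 + \<kappa> * (\<phi> t)^4 / 4) has_real_derivative 0)
      (at s within {0..})"
    using \<phi>[of s] \<psi>[of s]
    by (auto intro!: derivative_eq_intros simp: field_simps power_numeral_reduce)
qed (rule t)

lemma duffing_amplitude_bound: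
  fixes x y :: real
  assumes "0 < \<omega>" "0 < \<kappa>"
    and energy: "y\<^sup>2 / 2 + \<omega>\<^sup>2 * x\<^sup>2 / 2 + \<kappa> * x^4 / 4 = \<omega>\<^sup>2 * A\<^sup>2 / 2 + \<kappa> * A^4 / 4"
  shows "x\<^sup>2 \<le> A\<^sup>2"
proof (rule ccontr)
  assume "\<not> x\<^sup>2 \<le> A\<^sup>2"
  then have lt: "A\<^sup>2 < x\<^sup>2" by simp
  then have "(A\<^sup>2)\<^sup>2 < (x\<^sup>2)\<^sup>2" by (rule power_strict_mono) auto
  then have "\<kappa> * A^4 < \<kappa> * x^4" using assms by simp
  moreover have "\<omega>\<^sup>2 * A\<^sup>2 < \<omega>\<^sup>2 * x\<^sup>2" using lt assms by simp
  ultimately show False using energy zero_le_power2[of y] by linarith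
qed

text \<open>
  The phase curve \<open>z = \<phi>'/g + \<i> \<phi>\<close> with \<open>g = \<surd>(\<omega>\<^sup>2 + \<kappa>/2 (A\<^sup>2 + \<phi>\<^sup>2))\<close> lies on the circle of radius
  \<open>A\<close> by conservation of energy, and \<open>z' = \<i> g z\<close>. So \<open>\<phi> = A sin \<theta>\<close> with an angle that solves the
  autonomous equation \<open>\<theta>' = G \<theta>\<close>, where \<open>G = duffing_speed \<omega> \<kappa> A\<close> is positive and \<open>\<pi>\<close>-periodic.
  The time needed to reach an angle is the primitive \<open>F\<close> of \<open>1/G\<close>; it grows by the half period
  when the angle grows by \<open>\<pi>\<close>, and it is injective, so \<open>\<theta>\<close> advances by exactly \<open>\<pi>\<close> in that time.
\<close>

theorem duffing_half_period_antiperiodic: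
  assumes \<phi>: "\<And>t. 0 \<le> t \<Longrightarrow> (\<phi> has_real_derivative \<psi> t) (at t within {0..})"
    and \<psi>: "\<And>t. 0 \<le> t \<Longrightarrow> (\<psi> has_real_derivative - (\<omega>\<^sup>2 * \<phi> t + \<kappa> * (\<phi> t)^3)) (at t within {0..})"
    and pos: "0 < \<omega>" "0 < \<kappa>" "0 < A"
    and energy: "(\<psi> 0)\<^sup>2 / 2 + \<omega>\<^sup>2 * (\<phi> 0)\<^sup>2 / 2 + \<kappa> * (\<phi> 0)^4 / 4 = \<omega>\<^sup>2 * A\<^sup>2 / 2 + \<kappa> * A^4 / 4"
    and t: "0 \<le> t"
  shows "\<phi> (t + duffing_half_period \<omega> \<kappa> A) = - \<phi> t"
proof -
  define \<tau> where "\<tau> = duffing_half_period \<omega> \<kappa> A"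
  define G where "G = duffing_speed \<omega> \<kappa> A"
  have G: "0 < G u" "G u \<le> sqrt (\<omega>\<^sup>2 + \<kappa> * A\<^sup>2)" for u
    using duffing_speed_bounds[OF pos(1,2)] by (auto simp: G_def)
  have smax: "0 < sqrt (\<omega>\<^sup>2 + \<kappa> * A\<^sup>2)" using G[of 0] by linarith
  have cons: "(\<psi> t)\<^sup>2 / 2 + \<omega>\<^sup>2 * (\<phi> t)\<^sup>2 / 2 + \<kappa> * (\<phi> t)^4 / 4 = \<omega>\<^sup>2 * A\<^sup>2 / 2 + \<kappa> * A^4 / 4"
    if "0 \<le> t" for t
    unfolding energy[symmetric]
    by (rule duffing_energy_conserved[of \<phi> \<psi> \<omega> \<kappa> t]) (fact \<phi> \<psi> that)+
  define g where "g t = sqrt (\<omega>\<^sup>2 + \<kappa> / 2 * (A\<^sup>2 + (\<phi> t)\<^sup>2))" for t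
  have g2: "(g t)\<^sup>2 = \<omega>\<^sup>2 + \<kappa> / 2 * (A\<^sup>2 + (\<phi> t)\<^sup>2)" and gpos: "0 < g t" for t
  proof -
    have "0 < \<omega>\<^sup>2 + \<kappa> / 2 * (A\<^sup>2 + (\<phi> t)\<^sup>2)" using pos by (intro add_pos_nonneg) auto
    then show "(g t)\<^sup>2 = \<omega>\<^sup>2 + \<kappa> / 2 * (A\<^sup>2 + (\<phi> t)\<^sup>2)" "0 < g t" by (auto simp: g_def)
  qed
  have \<psi>2: "(\<psi> t)\<^sup>2 = (g t)\<^sup>2 * (A\<^sup>2 - (\<phi> t)\<^sup>2)" if "0 \<le> t" for t
    using cons[OF that] unfolding g2 by (simp add: power_numeral_reduce field_simps)
  have g: "(g has_real_derivative \<kappa> / 2 * \<phi> t * \<psi> t / g t) (at t within {0..})" if "0 \<le> t" for t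
  proof -
    have "((\<lambda>t. sqrt (\<omega>\<^sup>2 + \<kappa> / 2 * (A\<^sup>2 + (\<phi> t)\<^sup>2))) has_real_derivative
        (\<kappa> * \<phi> t * \<psi> t) * (inverse (sqrt (\<omega>\<^sup>2 + \<kappa> / 2 * (A\<^sup>2 + (\<phi> t)\<^sup>2))) / 2)) (at t within {0..})"
      using \<phi>[OF that] gpos[of t] unfolding g_def
      by (auto intro!: derivative_eq_intros)
    then show ?thesis unfolding g_def[symmetric, abs_def] by (simp add: field_simps)
  qed
  define z where "z t = Complex (\<psi> t / g t) (\<phi> t)" for t
  define z' where "z' t = \<i> * of_real (g t) * z t" for t
  have cont: "continuous_on {0..} \<phi>" "continuous_on {0..} \<psi>" "continuous_on {0..} g"
    using \<phi> \<psi> g by (auto intro!: DERIV_continuous_on)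
  have z: "(z has_vector_derivative z' t) (at t within {0..})" if "0 \<le> t" for t
  proof -
    have "((\<lambda>t. \<psi> t / g t) has_real_derivative
       (- (\<omega>\<^sup>2 * \<phi> t + \<kappa> * (\<phi> t)^3) * g t - \<psi> t * (\<kappa> / 2 * \<phi> t * \<psi> t / g t)) / (g t * g t)) (at t within {0..})"
      by (rule DERIV_divide[OF \<psi>[OF that] g[OF that]]) (use gpos[of t] in auto)
    moreover have "(- (\<omega>\<^sup>2 * \<phi> t + \<kappa> * (\<phi> t)^3) * g t - \<psi> t * (\<kappa> / 2 * \<phi> t * \<psi> t / g t)) / (g t * g t) = - g t * \<phi> t"
    proof -
      have "\<psi> t * (\<kappa> / 2 * \<phi> t * \<psi> t / g t) = \<kappa> / 2 * \<phi> t * (\<psi> t)\<^sup>2 / g t"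
        by (simp add: power2_eq_square)
      also have "\<dots> = \<kappa> / 2 * \<phi> t * g t * (A\<^sup>2 - (\<phi> t)\<^sup>2)"
        unfolding \<psi>2[OF that] using gpos[of t] by (simp add: power2_eq_square)
      finally have "- (\<omega>\<^sup>2 * \<phi> t + \<kappa> * (\<phi> t)^3) * g t - \<psi> t * (\<kappa> / 2 * \<phi> t * \<psi> t / g t)
          = - g t * \<phi> t * (\<omega>\<^sup>2 + \<kappa> / 2 * (A\<^sup>2 + (\<phi> t)\<^sup>2))"
        by (simp add: power_numeral_reduce field_simps)
      also have "\<dots> = - g t * \<phi> t * (g t * g t)" unfolding g2[symmetric] by (simp add: power2_eq_square)
      finally show ?thesis using gpos[of t] by simp
    qed
    ultimately show ?thesis
      using \<phi>[OF that] gpos[of t] unfolding z_def z'_def has_vector_derivative_complex_iff by simp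
  qed
  have norm2: "(\<psi> t / g t)\<^sup>2 + (\<phi> t)\<^sup>2 = A\<^sup>2" if "0 \<le> t" for t
    unfolding power_divide \<psi>2[OF that] using gpos[of t] by simp
  have nz: "z t \<noteq> 0" if "0 \<le> t" for t
    using norm2[OF that] pos(3) by (auto simp: z_def complex_eq_iff)
  have "continuous_on {0..} z'"
    unfolding z'_def z_def Complex_eq using cont gpos
    by (intro continuous_intros) (auto simp: less_imp_neq[symmetric])
  from complex_log_lift[OF z this nz]
  obtain L where L: "L 0 = 0"
    "\<And>t. 0 \<le> t \<Longrightarrow> (L has_vector_derivative z' t / z t) (at t within {0..})"
    "\<And>t. 0 \<le> t \<Longrightarrow> z t = z 0 * exp (L t)" by blast
  have L': "(L has_vector_derivative \<i> * of_real (g t)) (at t within {0..})" if "0 \<le> t" for t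
    using L(2)[OF that] nz[OF that] by (simp add: z'_def)
  have ReL: "Re (L t) = 0" if "0 \<le> t" for t
    using constant_if_deriv_0_halfline[of 0 "\<lambda>t. Re (L t)" t] has_field_derivative_Re[OF L'] L(1) that
    by simp
  have "(\<psi> 0 / g 0 / A)\<^sup>2 + (\<phi> 0 / A)\<^sup>2 = ((\<psi> 0 / g 0)\<^sup>2 + (\<phi> 0)\<^sup>2) / A\<^sup>2"
    by (simp only: power_divide add_divide_distrib)
  also have "\<dots> = 1" using norm2[of 0] pos(3) by simp
  finally have "(\<psi> 0 / g 0 / A)\<^sup>2 + (\<phi> 0 / A)\<^sup>2 = 1" .
  then obtain \<theta>0 where \<theta>0: "0 \<le> \<theta>0" "\<psi> 0 / g 0 / A = cos \<theta>0" "\<phi> 0 / A = sin \<theta>0"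
    using sincos_total_2pi by metis
  define \<theta> where "\<theta> t = \<theta>0 + Im (L t)" for t
  have \<phi>_sin: "\<phi> t = A * sin (\<theta> t)" if "0 \<le> t" for t
  proof -
    have "\<phi> t = Im (z 0 * exp (L t))" using L(3)[OF that] by (metis z_def complex.sel(2))
    also have "\<dots> = (\<psi> 0 / g 0) * sin (Im (L t)) + \<phi> 0 * cos (Im (L t))"
      using ReL[OF that] by (simp add: Im_exp Re_exp z_def)
    also have "\<psi> 0 / g 0 = A * cos \<theta>0" using \<theta>0(2)[symmetric] pos(3) by simp
    also have "\<phi> 0 = A * sin \<theta>0" using \<theta>0(3)[symmetric] pos(3) by simp
    also have "A * cos \<theta>0 * sin (Im (L t)) + A * sin \<theta>0 * cos (Im (L t)) = A * sin (\<theta> t)"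
      by (simp add: \<theta>_def sin_add algebra_simps)
    finally show ?thesis .
  qed
  have g_G: "g t = G (\<theta> t)" if "0 \<le> t" for t
    unfolding g_def G_def duffing_speed_def \<phi>_sin[OF that]
    by (simp add: power_mult_distrib algebra_simps)
  have \<theta>: "(\<theta> has_real_derivative G (\<theta> t)) (at t within {0..})" if "0 \<le> t" for t
    using DERIV_add[OF DERIV_const[of \<theta>0] has_field_derivative_Im[OF L'[OF that]]]
    by (simp add: \<theta>_def[abs_def] g_G[OF that, unfolded \<theta>_def])
  have \<theta>_nonneg: "0 \<le> \<theta> t" if "0 \<le> t" for t
    using mono_if_deriv_nonneg_halfline[of 0 \<theta> "\<lambda>t. G (\<theta> t)" t] \<theta> G that \<theta>0(1) L(1)
    by (force simp: \<theta>_def less_imp_le)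
  define F where "F u = integral {0..u} (\<lambda>u. 1 / G u)" for u
  have F: "(F has_real_derivative 1 / G u) (at u within {0..})" if "0 \<le> u" for u
    unfolding F_def has_real_derivative_iff_has_vector_derivative
    by (rule integral_has_vector_derivative_halfline[of 0 "\<lambda>u. 1 / G u"])
       (use that continuous_on_inverse_duffing_speed[OF pos(1,2)] in \<open>auto simp: G_def\<close>)
  have F_strict: "F u < F v" if "0 \<le> u" "u < v" for u v
  proof -
    \<comment> \<open>A positive lower bound of the derivative of \<open>F\<close>.\<close>
    define c where "c = 1 / sqrt (\<omega>\<^sup>2 + \<kappa> * A\<^sup>2)"
    have "F u - c * u \<le> F v - c * v"
    proof (rule mono_if_deriv_nonneg_halfline[where f="\<lambda>v. F v - c * v" and c=u])
      fix s assume s: "u \<le> s"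
      then have "(F has_real_derivative 1 / G s) (at s within {u..})"
        using F[of s] that by (auto intro: has_field_derivative_subset)
      then show "((\<lambda>v. F v - c * v) has_real_derivative 1 / G s - c) (at s within {u..})"
        by (auto intro!: derivative_eq_intros)
      show "0 \<le> 1 / G s - c" unfolding c_def using G[of s] by (simp add: frac_le)
    qed (use that in auto)
    moreover have "c * u < c * v" using that smax by (simp add: c_def divide_strict_right_mono)
    ultimately show ?thesis by linarith
  qed
  have F_time: "F (\<theta> t) = F \<theta>0 + t" if "0 \<le> t" for t
  proof -
    have "F (\<theta> t) - t = F (\<theta> 0) - 0"
    proof (rule constant_if_deriv_0_halfline[where f="\<lambda>t. F (\<theta> t) - t" and c=0])
      fix s :: real assume s: "0 \<le> s"
      have "((F \<circ> \<theta>) has_real_derivative 1 / G (\<theta> s) * G (\<theta> s)) (at s within {0..})"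
        by (rule DERIV_image_chain)
          (use \<theta>[OF s] F[OF \<theta>_nonneg[OF s]] \<theta>_nonneg in \<open>auto intro: has_field_derivative_subset\<close>)
      then have "((\<lambda>t. F (\<theta> t)) has_real_derivative 1) (at s within {0..})"
        using G[of "\<theta> s"] by (simp add: o_def)
      from DERIV_diff[OF this DERIV_ident]
      show "((\<lambda>t. F (\<theta> t) - t) has_real_derivative 0) (at s within {0..})" by simp
    qed (use that in auto)
    then show ?thesis by (simp add: \<theta>_def L(1))
  qed
  have G_pi: "G (u + pi) = G u" for u by (simp add: G_def duffing_speed_def)
  have F_pi: "F (u + pi) = F u + \<tau>" if "0 \<le> u" for u
  proof -
    have "F (u + pi) - F u = F (0 + pi) - F 0"
    proof (rule constant_if_deriv_0_halfline[where f="\<lambda>u. F (u + pi) - F u" and c=0])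
      fix s :: real assume s: "0 \<le> s"
      have "((\<lambda>u. F (u + pi)) has_real_derivative 1 / G (s + pi)) (at s within {0..})"
        by (rule deriv_shift_halfline[of F "\<lambda>u. 1 / G u"]) (use F s in auto)
      from DERIV_diff[OF this F[OF s]]
      show "((\<lambda>u. F (u + pi) - F u) has_real_derivative 0) (at s within {0..})" by (simp add: G_pi)
    qed (use that in auto)
    then show ?thesis by (simp add: F_def \<tau>_def duffing_half_period_def G_def)
  qed
  have "0 \<le> pi / sqrt (\<omega>\<^sup>2 + \<kappa> * A\<^sup>2)" using smax by simp
  then have \<tau>: "0 \<le> \<tau>"
    using duffing_half_period_bounds(1)[OF pos(1,2), of A] unfolding \<tau>_def by linarith
  have "F (\<theta> (t + \<tau>)) = F (\<theta> t + pi)"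
    using F_time[OF t] F_time[of "t + \<tau>"] F_pi[OF \<theta>_nonneg[OF t]] t \<tau> by simp
  then have "\<theta> (t + \<tau>) = \<theta> t + pi"
    using F_strict[of "\<theta> (t + \<tau>)" "\<theta> t + pi"] F_strict[of "\<theta> t + pi" "\<theta> (t + \<tau>)"]
      \<theta>_nonneg[OF t] \<theta>_nonneg[of "t + \<tau>"] t \<tau> by force
  then show "\<phi> (t + duffing_half_period \<omega> \<kappa> A) = - \<phi> t"
    using \<phi>_sin[of "t + \<tau>"] \<phi>_sin[OF t] t \<tau> by (simp add: \<tau>_def)
qed

text \<open>
  The amplitude of a Duffing oscillation is the nonnegative displacement whose potential energy
  equals the total energy.
\<close>

lemma duffing_amplitude_exists:
  fixes E :: real
  assumes "0 < \<omega>" "0 < \<kappa>" "0 \<le> E"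
  obtains A where "0 \<le> A" "\<omega>\<^sup>2 * A\<^sup>2 / 2 + \<kappa> * A^4 / 4 = E" "A\<^sup>2 \<le> 2 * E / \<omega>\<^sup>2"
proof -
  let ?V = "\<lambda>A. \<omega>\<^sup>2 * A\<^sup>2 / 2 + \<kappa> * A^4 / 4"
  have "\<exists>A. 0 \<le> A \<and> A \<le> sqrt (2 * E) / \<omega> \<and> ?V A = E"
  proof (rule IVT')
    show "E \<le> ?V (sqrt (2 * E) / \<omega>)"
      using assms by (simp add: power_divide)
  qed (use assms in \<open>auto intro!: continuous_intros\<close>)
  then obtain A where A: "0 \<le> A" "?V A = E" by blast
  have "\<omega>\<^sup>2 * A\<^sup>2 \<le> 2 * E" using A(2) assms(2) zero_le_power[of "A\<^sup>2" 2] by (simp flip: A(2))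
  then have "A\<^sup>2 \<le> 2 * E / \<omega>\<^sup>2" using assms(1) by (simp add: pos_le_divide_eq mult.commute)
  with A that show ?thesis by blast
qed

text \<open>
  The hypotheses of Zhukovskii's criterion for \<open>a = \<alpha>\<^sup>2 + s \<phi>\<^sup>2\<close> with \<open>\<alpha>\<^sup>2 \<le> a \<le> \<alpha>\<^sup>2 + s A\<^sup>2\<close>. With
  \<open>K \<omega> < \<alpha> \<le> (K + 1) \<omega>\<close>, the lower inequality and, if \<open>\<alpha> < (K + 1) \<omega>\<close>, the upper one hold strictly
  in the limit \<open>A = 0\<close> and survive for small \<open>A\<close>. In the resonant case \<open>\<alpha> = (K + 1) \<omega>\<close> the upper
  inequality reads \<open>\<tau> < \<pi> / \<surd>(\<omega>\<^sup>2 + \<rho> A\<^sup>2)\<close> with \<open>\<rho> = s / (K + 1)\<^sup>2\<close>, which is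
  \<open>duffing_half_period_less\<close>.
\<close>

lemma small_amplitude_rotation:
  assumes pos: "0 < \<omega>" "0 < \<kappa>" "0 < \<alpha>" "0 \<le> s"
    and res: "\<alpha> / \<omega> \<notin> \<nat> - {0} \<or> 4 * s < 3 * \<kappa>"
  obtains K a0 where "0 < a0"
    "\<And>A. 0 < A \<Longrightarrow> A\<^sup>2 \<le> a0 \<Longrightarrow> real K * pi < \<alpha> * duffing_half_period \<omega> \<kappa> A"
    "\<And>A. 0 < A \<Longrightarrow> A\<^sup>2 \<le> a0 \<Longrightarrow>
       sqrt (\<alpha>\<^sup>2 + s * A\<^sup>2) * duffing_half_period \<omega> \<kappa> A < (real K + 1) * pi"
proof -
  \<comment> \<open>The ceiling, not the floor, so that a resonance \<open>\<alpha> = N \<omega>\<close> falls into the band below \<open>N\<close>.\<close>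
  define K where "K = nat (\<lceil>\<alpha> / \<omega>\<rceil> - 1)"
  have "0 < \<alpha> / \<omega>" using pos by simp
  then have "1 \<le> \<lceil>\<alpha> / \<omega>\<rceil>" by linarith
  then have rK: "real K = of_int \<lceil>\<alpha> / \<omega>\<rceil> - 1" by (simp add: K_def of_nat_nat)
  then have "real K < \<alpha> / \<omega>" "\<alpha> / \<omega> \<le> real K + 1" by linarith+
  then have K: "real K * \<omega> < \<alpha>" "\<alpha> \<le> (real K + 1) * \<omega>" using pos by (simp_all add: field_simps)
  have "(real K * \<omega>)\<^sup>2 < \<alpha>\<^sup>2" using K(1) pos by (intro power_strict_mono) auto
  then have gap: "0 < \<alpha>\<^sup>2 - (real K)\<^sup>2 * \<omega>\<^sup>2" by (simp add: power_mult_distrib)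
  define a1 where "a1 = (\<alpha>\<^sup>2 - (real K)\<^sup>2 * \<omega>\<^sup>2) / ((real K)\<^sup>2 * \<kappa> + 1)"
  have den: "0 < (real K)\<^sup>2 * \<kappa> + 1" using pos by (simp add: add_nonneg_pos)
  have a1: "0 < a1" using gap den by (simp add: a1_def)
  have lower: "real K * pi < \<alpha> * duffing_half_period \<omega> \<kappa> A" if A: "0 < A" "A\<^sup>2 \<le> a1" for A
  proof -
    have "A\<^sup>2 * ((real K)\<^sup>2 * \<kappa> + 1) \<le> \<alpha>\<^sup>2 - (real K)\<^sup>2 * \<omega>\<^sup>2"
      using A(2) den by (simp add: a1_def pos_le_divide_eq)
    then have "(real K)\<^sup>2 * (\<omega>\<^sup>2 + \<kappa> * A\<^sup>2) + A\<^sup>2 \<le> \<alpha>\<^sup>2" by (simp add: algebra_simps)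
    moreover have "0 < A\<^sup>2" using A by simp
    ultimately have "(real K)\<^sup>2 * (\<omega>\<^sup>2 + \<kappa> * A\<^sup>2) < \<alpha>\<^sup>2" by linarith
    then have "sqrt ((real K)\<^sup>2 * (\<omega>\<^sup>2 + \<kappa> * A\<^sup>2)) < sqrt (\<alpha>\<^sup>2)" by (rule real_sqrt_less_mono)
    then have "real K * sqrt (\<omega>\<^sup>2 + \<kappa> * A\<^sup>2) < \<alpha>" using pos by (simp add: real_sqrt_mult)
    moreover have s: "0 < sqrt (\<omega>\<^sup>2 + \<kappa> * A\<^sup>2)" using pos by (simp add: add_pos_nonneg)
    ultimately have "real K * pi < \<alpha> * (pi / sqrt (\<omega>\<^sup>2 + \<kappa> * A\<^sup>2))"
      by (simp add: pos_less_divide_eq mult.commute mult.left_commute)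
    also have "\<dots> \<le> \<alpha> * duffing_half_period \<omega> \<kappa> A"
      using duffing_half_period_bounds(1)[OF pos(1,2)] pos by (intro mult_left_mono) auto
    finally show ?thesis .
  qed
  show ?thesis
  proof (cases "\<alpha> = (real K + 1) * \<omega>")
    case False
    with K(2) have "\<alpha> < (real K + 1) * \<omega>" by simp
    then have "\<alpha>\<^sup>2 < ((real K + 1) * \<omega>)\<^sup>2" using pos by (intro power_strict_mono) auto
    then have gap2: "0 < ((real K + 1) * \<omega>)\<^sup>2 - \<alpha>\<^sup>2" by simp
    define a2 where "a2 = (((real K + 1) * \<omega>)\<^sup>2 - \<alpha>\<^sup>2) / (s + 1)"
    have a2: "0 < a2" using gap2 pos by (simp add: a2_def)
    have upper: "sqrt (\<alpha>\<^sup>2 + s * A\<^sup>2) * duffing_half_period \<omega> \<kappa> A < (real K + 1) * pi"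
      if A: "0 < A" "A\<^sup>2 \<le> a2" for A
    proof -
      have "A\<^sup>2 * (s + 1) \<le> ((real K + 1) * \<omega>)\<^sup>2 - \<alpha>\<^sup>2"
        using A(2) pos by (simp add: a2_def pos_le_divide_eq)
      then have "\<alpha>\<^sup>2 + s * A\<^sup>2 + A\<^sup>2 \<le> ((real K + 1) * \<omega>)\<^sup>2" by (simp add: algebra_simps)
      moreover have "0 < A\<^sup>2" using A by simp
      ultimately have "\<alpha>\<^sup>2 + s * A\<^sup>2 < ((real K + 1) * \<omega>)\<^sup>2" by linarith
      then have "sqrt (\<alpha>\<^sup>2 + s * A\<^sup>2) < (real K + 1) * \<omega>"
        using pos by (intro real_less_lsqrt) auto
      then have "sqrt (\<alpha>\<^sup>2 + s * A\<^sup>2) * (pi / \<omega>) < (real K + 1) * \<omega> * (pi / \<omega>)"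
        using pos by (intro mult_strict_right_mono) auto
      moreover have "sqrt (\<alpha>\<^sup>2 + s * A\<^sup>2) * duffing_half_period \<omega> \<kappa> A \<le> sqrt (\<alpha>\<^sup>2 + s * A\<^sup>2) * (pi / \<omega>)"
        using duffing_half_period_bounds(2)[OF pos(1,2)] pos by (intro mult_left_mono) auto
      ultimately show ?thesis using pos by simp
    qed
    show ?thesis by (rule that[of "min a1 a2" K]) (use a1 a2 lower upper in auto)
  next
    case True
    then have "\<alpha> / \<omega> = real (Suc K)" using pos by (simp add: field_simps)
    then have "\<alpha> / \<omega> \<in> \<nat> - {0}" by (simp only: Diff_iff of_nat_in_Nats singleton_iff of_nat_eq_0_iff) simp
    with res have sk: "4 * s < 3 * \<kappa>" by blast
    define \<rho> where "\<rho> = s / (real K + 1)\<^sup>2"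
    have "s * 1 \<le> s * (real K + 1)\<^sup>2" using pos by (intro mult_left_mono) (auto simp: one_le_power)
    then have \<rho>: "0 \<le> \<rho>" "\<rho> \<le> s" using pos by (simp_all add: \<rho>_def pos_divide_le_eq)
    define a2 where "a2 = (3 * \<kappa> / 8 - s / 2) * \<omega>\<^sup>2 / (2 * \<kappa>\<^sup>2)"
    have a2: "0 < a2" using sk pos by (simp add: a2_def)
    have upper: "sqrt (\<alpha>\<^sup>2 + s * A\<^sup>2) * duffing_half_period \<omega> \<kappa> A < (real K + 1) * pi"
      if A: "0 < A" "A\<^sup>2 \<le> a2" for A
    proof -
      have "2 * (\<kappa>\<^sup>2 * A\<^sup>2) \<le> (3 * \<kappa> / 8 - s / 2) * \<omega>\<^sup>2"
        using A(2) pos by (simp add: a2_def pos_le_divide_eq mult.commute mult.left_commute)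
      moreover have "0 < \<kappa>\<^sup>2 * A\<^sup>2" using A pos by simp
      moreover have "(3 * \<kappa> / 8 - s / 2) * \<omega>\<^sup>2 \<le> (3 * \<kappa> / 8 - \<rho> / 2) * \<omega>\<^sup>2"
        using \<rho> by (intro mult_right_mono) auto
      ultimately have "\<kappa>\<^sup>2 * A\<^sup>2 < (3 * \<kappa> / 8 - \<rho> / 2) * \<omega>\<^sup>2" by linarith
      then have lt: "duffing_half_period \<omega> \<kappa> A < pi / sqrt (\<omega>\<^sup>2 + \<rho> * A\<^sup>2)"
        using duffing_half_period_less[OF pos(1,2) A(1) \<rho>(1)] \<rho> sk by simp
      have r: "0 < sqrt (\<omega>\<^sup>2 + \<rho> * A\<^sup>2)" using pos \<rho> by (simp add: add_pos_nonneg)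
      have "\<alpha>\<^sup>2 + s * A\<^sup>2 = (real K + 1)\<^sup>2 * (\<omega>\<^sup>2 + \<rho> * A\<^sup>2)"
        using True by (simp add: \<rho>_def power_mult_distrib distrib_left)
      then have eq: "sqrt (\<alpha>\<^sup>2 + s * A\<^sup>2) = (real K + 1) * sqrt (\<omega>\<^sup>2 + \<rho> * A\<^sup>2)"
        by (simp add: real_sqrt_mult)
      then have "sqrt (\<alpha>\<^sup>2 + s * A\<^sup>2) * duffing_half_period \<omega> \<kappa> A
          < sqrt (\<alpha>\<^sup>2 + s * A\<^sup>2) * (pi / sqrt (\<omega>\<^sup>2 + \<rho> * A\<^sup>2))"
        using lt r by (intro mult_strict_left_mono) auto
      also have "\<dots> = (real K + 1) * pi" unfolding eq using r by simp
      finally show ?thesis .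
    qed
    show ?thesis by (rule that[of "min a1 a2" K]) (use a1 a2 lower upper in auto)
  qed
qed


section \<open>From the plate equation to the Duffing equation\<close>

lemma dx_cong:
  assumes "\<And>p. p \<in> closed_plate l \<Longrightarrow> f p = g p" "p \<in> closed_plate l"
  shows "dx f p = dx g p"
  unfolding dx_def by (rule deriv_on_cong) (use assms in \<open>auto simp: closed_plate_def\<close>)

lemma dy_cong:
  assumes "\<And>p. p \<in> closed_plate l \<Longrightarrow> f p = g p" "p \<in> closed_plate l"
  shows "dy l f p = dy l g p"
  unfolding dy_def by (rule deriv_on_cong) (use assms in \<open>auto simp: closed_plate_def\<close>)

lemma laplacian_cong:
  assumes "\<And>p. p \<in> closed_plate l \<Longrightarrow> f p = g p" "p \<in> closed_plate l"
  shows "laplacian l f p = laplacian l g p"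
proof -
  have "dx (dx f) p = dx (dx g) p" by (intro dx_cong) (use assms in auto)
  moreover have "dy l (dy l f) p = dy l (dy l g) p" by (intro dy_cong) (use assms in auto)
  ultimately show ?thesis by (simp add: laplacian_def)
qed

lemma differentiable_on_cong:
  assumes "\<And>x. x \<in> A \<Longrightarrow> f x = g x"
  shows "f differentiable_on A \<longleftrightarrow> g differentiable_on A"
proof -
  have "(f has_derivative D) (at x within A) \<longleftrightarrow> (g has_derivative D) (at x within A)" if "x \<in> A" for x D
    using assms that has_derivative_transform[of x A f g D] has_derivative_transform[of x A g f D]
    by auto
  then show ?thesis unfolding differentiable_on_def differentiable_def by auto
qed

text \<open>
  The partial derivatives are taken along segments of the closed plate, so they see only
  the values there. This allows rewriting inside iterated derivatives.
\<close>

lemma Ck_closed_plate_cong: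
  assumes "\<And>p. p \<in> closed_plate l \<Longrightarrow> f p = g p"
  shows "Ck_closed_plate l k f \<longleftrightarrow> Ck_closed_plate l k g"
  using assms
proof (induction k arbitrary: f g)
  case 0
  then show ?case by (auto cong: continuous_on_cong)
next
  case (Suc k)
  have "continuous_on (closed_plate l) f \<longleftrightarrow> continuous_on (closed_plate l) g"
    using Suc.prems by (auto cong: continuous_on_cong)
  moreover have "(\<lambda>x. f (x, y)) differentiable_on {0..pi} \<longleftrightarrow> (\<lambda>x. g (x, y)) differentiable_on {0..pi}"
    if "y \<in> {-l..l}" for y
    by (rule differentiable_on_cong) (use Suc.prems that in \<open>auto simp: closed_plate_def\<close>)
  moreover have "(\<lambda>y. f (x, y)) differentiable_on {-l..l} \<longleftrightarrow> (\<lambda>y. g (x, y)) differentiable_on {-l..l}"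
    if "x \<in> {0..pi}" for x
    by (rule differentiable_on_cong) (use Suc.prems that in \<open>auto simp: closed_plate_def\<close>)
  moreover have "Ck_closed_plate l k (dx f) \<longleftrightarrow> Ck_closed_plate l k (dx g)"
    by (rule Suc.IH) (use Suc.prems in \<open>rule dx_cong\<close>)
  moreover have "Ck_closed_plate l k (dy l f) \<longleftrightarrow> Ck_closed_plate l k (dy l g)"
    by (rule Suc.IH) (use Suc.prems in \<open>rule dy_cong\<close>)
  ultimately show ?case by simp
qed

lemma dx_lincomb:
  assumes "Ck_closed_plate l (Suc k) f" "Ck_closed_plate l (Suc k) g" "p \<in> closed_plate l"
  shows "dx (\<lambda>p. a * f p + b * g p) p = a * dx f p + b * dx g p"
proof -
  have xy: "fst p \<in> {0..pi}" "snd p \<in> {-l..l}" using assms(3) by (auto simp: closed_plate_def)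
  then have "((\<lambda>s. f (s, snd p)) has_real_derivative dx f p) (at (fst p) within {0..pi})"
      "((\<lambda>s. g (s, snd p)) has_real_derivative dx g p) (at (fst p) within {0..pi})"
    using assms(1,2) by (auto simp: dx_def intro!: deriv_on_works)
  then show ?thesis
    unfolding dx_def[of "\<lambda>p. a * f p + b * g p"]
    by (intro deriv_on_eqI at_within_interval_neq_bot xy) (auto intro!: derivative_eq_intros)
qed

lemma dy_lincomb:
  assumes "0 < l" "Ck_closed_plate l (Suc k) f" "Ck_closed_plate l (Suc k) g" "p \<in> closed_plate l"
  shows "dy l (\<lambda>p. a * f p + b * g p) p = a * dy l f p + b * dy l g p"
proof -
  have xy: "fst p \<in> {0..pi}" "snd p \<in> {-l..l}" using assms(4) by (auto simp: closed_plate_def)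
  then have "((\<lambda>s. f (fst p, s)) has_real_derivative dy l f p) (at (snd p) within {-l..l})"
      "((\<lambda>s. g (fst p, s)) has_real_derivative dy l g p) (at (snd p) within {-l..l})"
    using assms(2,3) by (auto simp: dy_def intro!: deriv_on_works)
  then show ?thesis
    unfolding dy_def[of l "\<lambda>p. a * f p + b * g p"]
    by (intro deriv_on_eqI at_within_interval_neq_bot xy)
      (use \<open>0 < l\<close> in \<open>auto intro!: derivative_eq_intros\<close>)
qed

lemma Ck_closed_plate_lincomb:
  assumes "0 < l" "Ck_closed_plate l k f" "Ck_closed_plate l k g"
  shows "Ck_closed_plate l k (\<lambda>p. a * f p + b * g p)"
  using assms(2,3)
proof (induction k arbitrary: f g)
  case 0
  then show ?case by (auto intro!: continuous_intros)
next
  case (Suc k)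
  have "Ck_closed_plate l k (\<lambda>p. a * dx f p + b * dx g p)"
    by (rule Suc.IH) (use Suc.prems in auto)
  moreover have "Ck_closed_plate l k (dx (\<lambda>p. a * f p + b * g p))
      \<longleftrightarrow> Ck_closed_plate l k (\<lambda>p. a * dx f p + b * dx g p)"
    by (rule Ck_closed_plate_cong, rule dx_lincomb[OF Suc.prems])
  moreover have "Ck_closed_plate l k (\<lambda>p. a * dy l f p + b * dy l g p)"
    by (rule Suc.IH) (use Suc.prems in auto)
  moreover have "Ck_closed_plate l k (dy l (\<lambda>p. a * f p + b * g p))
      \<longleftrightarrow> Ck_closed_plate l k (\<lambda>p. a * dy l f p + b * dy l g p)"
    by (rule Ck_closed_plate_cong, rule dy_lincomb[OF assms(1) Suc.prems])
  ultimately show ?case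
    using Suc.prems by (auto intro!: continuous_intros derivative_intros)
qed

lemma laplacian_scale:
  assumes "0 < l" "Ck_closed_plate l (Suc (Suc k)) f" "p \<in> closed_plate l"
  shows "dx (\<lambda>p. c * f p) p = c * dx f p"
    and "dx (dx (\<lambda>p. c * f p)) p = c * dx (dx f) p"
    and "laplacian l (\<lambda>p. c * f p) p = c * laplacian l f p"
proof -
  have x: "dx (\<lambda>p. c * g p) q = c * dx g q"
    if "Ck_closed_plate l (Suc j) g" "q \<in> closed_plate l" for g j q
    using dx_lincomb[OF that(1,1,2), of c 0] by simp
  have y: "dy l (\<lambda>p. c * g p) q = c * dy l g q"
    if "Ck_closed_plate l (Suc j) g" "q \<in> closed_plate l" for g j q
    using dy_lincomb[OF assms(1) that(1,1,2), of c 0] by simp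
  show "dx (\<lambda>p. c * f p) p = c * dx f p" by (rule x[OF assms(2,3)])
  have "dx (dx (\<lambda>p. c * f p)) p = dx (\<lambda>p. c * dx f p) p"
    by (rule dx_cong[OF x[OF assms(2)] assms(3)])
  also have "\<dots> = c * dx (dx f) p" by (rule x[of k]) (use assms in auto)
  finally show xx: "dx (dx (\<lambda>p. c * f p)) p = c * dx (dx f) p" .
  have "dy l (dy l (\<lambda>p. c * f p)) p = dy l (\<lambda>p. c * dy l f p) p"
    by (rule dy_cong[OF y[OF assms(2)] assms(3)])
  also have "\<dots> = c * dy l (dy l f) p" by (rule y[of k]) (use assms in auto)
  finally show "laplacian l (\<lambda>p. c * f p) p = c * laplacian l f p"
    unfolding laplacian_def xx by (simp add: algebra_simps)
qed

text \<open>
  Derivatives commute with scalar factors only where they exist; for the outer Laplacian this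
  requires the inner one to be of class \<open>C\<^sup>2\<close>, which is where sums of regular functions enter.
\<close>

lemma bilaplacian_scale:
  assumes "0 < l" "Ck_closed_plate l 4 f" "p \<in> closed_plate l"
  shows "laplacian l (laplacian l (\<lambda>p. c * f p)) p = c * laplacian l (laplacian l f) p"
proof -
  have C4: "Ck_closed_plate l (Suc (Suc (Suc (Suc 0)))) f" using assms(2) by (simp add: numeral_eq_Suc)
  have "Ck_closed_plate l (Suc (Suc 0)) (\<lambda>p. 1 * dx (dx f) p + 1 * dy l (dy l f) p)"
    by (rule Ck_closed_plate_lincomb[OF assms(1)]) (use C4 in auto)
  then have C2: "Ck_closed_plate l (Suc (Suc 0)) (laplacian l f)"
    by (simp add: laplacian_def[abs_def])
  have "laplacian l (laplacian l (\<lambda>p. c * f p)) p = laplacian l (\<lambda>p. c * laplacian l f p) p"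
    by (rule laplacian_cong[OF laplacian_scale(3)[OF assms(1) C4] assms(3)])
  also have "\<dots> = c * laplacian l (laplacian l f) p"
    by (rule laplacian_scale(3)[OF assms(1) C2 assms(3)])
  finally show ?thesis .
qed

lemma plate_subset_closed_plate: "plate l \<subseteq> closed_plate l"
  by (auto simp: plate_def closed_plate_def)

lemma dx_mode_shape:
  assumes "p \<in> closed_plate l"
  shows "dx (mode_shape \<psi> m i) p = real m * \<psi> m i (snd p) * cos (real m * fst p)"
    and "dx (dx (mode_shape \<psi> m i)) p = - (real m)\<^sup>2 * mode_shape \<psi> m i p"
proof -
  have d: "dx (mode_shape \<psi> m i) q = real m * \<psi> m i (snd q) * cos (real m * fst q)"
    if "q \<in> closed_plate l" for q
    unfolding dx_def mode_shape_def
    by (rule deriv_on_eqI, rule at_within_interval_neq_bot)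
      (use that in \<open>auto simp: closed_plate_def intro!: derivative_eq_intros\<close>)
  then show "dx (mode_shape \<psi> m i) p = real m * \<psi> m i (snd p) * cos (real m * fst p)"
    using assms .
  have "dx (dx (mode_shape \<psi> m i)) p = dx (\<lambda>q. real m * \<psi> m i (snd q) * cos (real m * fst q)) p"
    by (rule dx_cong[OF d assms])
  also have "\<dots> = - (real m)\<^sup>2 * mode_shape \<psi> m i p"
    unfolding dx_def mode_shape_def
    by (rule deriv_on_eqI, rule at_within_interval_neq_bot)
      (use assms in \<open>auto simp: closed_plate_def power2_eq_square intro!: derivative_eq_intros\<close>)
  finally show "dx (dx (mode_shape \<psi> m i)) p = - (real m)\<^sup>2 * mode_shape \<psi> m i p" .
qed

lemma integral_plate_separated:
  assumes g: "continuous_on {0..pi} g" and h: "continuous_on {-l..l} h"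
  shows "(LINT p:plate l|lborel. g (fst p) * h (snd p)) = integral {0..pi} g * (integral {-l..l} h :: real)"
proof -
  let ?f = "\<lambda>p. g (fst p) * h (snd p)"
  have box: "plate l = box (0, - l) (pi, l)" "closed_plate l = cbox (0, - l) (pi, l)"
    by (auto simp: plate_def closed_plate_def box_def cbox_def Basis_prod_def)
  have c: "continuous_on (closed_plate l) ?f"
    unfolding closed_plate_def
    by (intro continuous_on_mult continuous_on_compose2[OF g] continuous_on_compose2[OF h] continuous_intros) auto
  have "set_integrable lborel (closed_plate l) ?f"
    unfolding set_integrable_def by (rule borel_integrable_compact[OF _ c]) (simp add: box)
  then have "set_integrable lborel (plate l) ?f"
    by (rule set_integrable_subset[OF _ _ plate_subset_closed_plate]) (simp add: box)
  then have "(LINT p:plate l|lborel. ?f p) = integral (plate l) ?f"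
    by (rule set_borel_integral_eq_integral)
  also have "\<dots> = integral (cbox (0, - l) (pi, l)) ?f" unfolding box by (rule integral_open_interval)
  also have "\<dots> = integral {0..pi} (\<lambda>x. integral {-l..l} (\<lambda>y. g x * h y))"
    using integral_prod_continuous[OF c[unfolded box]] by simp
  also have "\<dots> = integral {0..pi} g * integral {-l..l} h" by simp
  finally show ?thesis .
qed

lemma integral_sin_cos_squared:
  assumes "1 \<le> m"
  shows "integral {0..pi} (\<lambda>x. (sin (real m * x))\<^sup>2) = pi / 2"
    and "integral {0..pi} (\<lambda>x. (cos (real m * x))\<^sup>2) = pi / 2"
proof -
  have m: "real m \<noteq> 0" using assms by simp
  have F: "((\<lambda>x. x / 2 + s * (sin (real m * x) * cos (real m * x) / (2 * real m))) has_vector_derivative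
      1 / 2 + s * ((cos (real m * x))\<^sup>2 - (sin (real m * x))\<^sup>2) / 2) (at x within {0..pi})" for s x
    unfolding has_real_derivative_iff_has_vector_derivative[symmetric]
    using m by (auto intro!: derivative_eq_intros simp: power2_eq_square field_simps)
  have "((\<lambda>x. 1 / 2 + s * ((cos (real m * x))\<^sup>2 - (sin (real m * x))\<^sup>2) / 2) has_integral pi / 2) {0..pi}" for s
    using fundamental_theorem_of_calculus[OF pi_ge_zero F[of s]] by simp
  note I = integral_unique[OF this]
  have "1 / 2 + (-1) * ((cos (real m * x))\<^sup>2 - (sin (real m * x))\<^sup>2) / 2 = (sin (real m * x))\<^sup>2"
       "1 / 2 + 1 * ((cos (real m * x))\<^sup>2 - (sin (real m * x))\<^sup>2) / 2 = (cos (real m * x))\<^sup>2" for x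
    using sin_cos_squared_add[of "real m * x"] by (simp_all add: field_simps)
  with I[of "-1"] I[of 1]
  show "integral {0..pi} (\<lambda>x. (sin (real m * x))\<^sup>2) = pi / 2"
    and "integral {0..pi} (\<lambda>x. (cos (real m * x))\<^sup>2) = pi / 2"
    by simp_all
qed

text \<open>
  In separated variables the \<open>x\<close>-derivative replaces \<open>sin (m x)\<close> by \<open>m cos (m x)\<close>, and the squares
  of both functions have the same integral over \<open>[0, \<pi>]\<close>.
\<close>

lemma mode_shape_gradient_norm:
  assumes "1 \<le> m" and cont: "continuous_on (closed_plate l) (mode_shape \<psi> m i)"
    and norm: "(LINT p:plate l|lborel. (mode_shape \<psi> m i p)\<^sup>2) = 1"
  shows "(LINT p:plate l|lborel. (dx (mode_shape \<psi> m i) p)\<^sup>2) = (real m)\<^sup>2"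
proof -
  \<comment> \<open>On the line \<open>x = \<pi>/(2m)\<close> the sine equals \<open>1\<close>, so the profile \<open>\<psi> m i\<close> inherits continuity.\<close>
  have "continuous_on {-l..l} (\<lambda>y. mode_shape \<psi> m i (pi / (2 * real m), y))"
    by (rule continuous_on_compose2[OF cont])
      (use assms(1) in \<open>auto simp: closed_plate_def field_simps intro!: continuous_intros\<close>)
  moreover have "mode_shape \<psi> m i (pi / (2 * real m), y) = \<psi> m i y" for y
    using assms(1) by (simp add: mode_shape_def)
  ultimately have h: "continuous_on {-l..l} (\<lambda>y. (\<psi> m i y)\<^sup>2)"
    by (auto intro!: continuous_intros)
  have sep: "(LINT p:plate l|lborel. g (fst p) * (\<psi> m i (snd p))\<^sup>2) =
      integral {0..pi} g * integral {-l..l} (\<lambda>y. (\<psi> m i y)\<^sup>2)"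
    if "continuous_on {0..pi} g" for g
    by (rule integral_plate_separated[OF that h])
  have "(LINT p:plate l|lborel. (mode_shape \<psi> m i p)\<^sup>2) = pi / 2 * integral {-l..l} (\<lambda>y. (\<psi> m i y)\<^sup>2)"
    using sep[of "\<lambda>x. (sin (real m * x))\<^sup>2"] integral_sin_cos_squared(1)[OF assms(1)]
    by (simp add: mode_shape_def power_mult_distrib mult.commute continuous_intros)
  with norm have C: "pi / 2 * integral {-l..l} (\<lambda>y. (\<psi> m i y)\<^sup>2) = 1" by simp
  have "plate l \<in> sets lborel" by (simp add: plate_def open_Times borel_open)
  then have "(LINT p:plate l|lborel. (dx (mode_shape \<psi> m i) p)\<^sup>2)
      = (LINT p:plate l|lborel. ((real m)\<^sup>2 * (cos (real m * fst p))\<^sup>2) * (\<psi> m i (snd p))\<^sup>2)"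
  proof (rule set_lebesgue_integral_cong, intro allI impI)
    fix p assume "p \<in> plate l"
    then have "p \<in> closed_plate l" using plate_subset_closed_plate by blast
    from dx_mode_shape(1)[OF this]
    show "(dx (mode_shape \<psi> m i) p)\<^sup>2 = ((real m)\<^sup>2 * (cos (real m * fst p))\<^sup>2) * (\<psi> m i (snd p))\<^sup>2"
      by (simp add: power_mult_distrib)
  qed
  also have "\<dots> = (real m)\<^sup>2 * (pi / 2 * integral {-l..l} (\<lambda>y. (\<psi> m i y)\<^sup>2))"
    using sep[of "\<lambda>x. (real m)\<^sup>2 * (cos (real m * x))\<^sup>2"] integral_sin_cos_squared(2)[OF assms(1)]
    by (simp add: continuous_intros)
  finally show ?thesis using C by simp
qed

text \<open>
  All terms of the plate equation are multiples of the mode shape; the coefficients are compared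
  at a point where it does not vanish. The plate equation is available for positive times, and
  the identity extends to \<open>t = 0\<close> by continuity of the second derivative.
\<close>

theorem simple_mode_duffing:
  assumes "0 < l" and sys: "buckling_system \<sigma> l \<psi> \<Lambda>" and mi: "1 \<le> m" "1 \<le> i"
    and mode: "simple_mode \<sigma> l P S \<psi> m i \<phi>" and t: "0 \<le> t"
  shows "deriv_on {0..} (deriv_on {0..} \<phi>) t =
     - ((real m)\<^sup>2 * (\<Lambda> m i - P) * \<phi> t + S * (real m)^4 * (\<phi> t)^3)"
proof -
  define w where "w = mode_shape \<psi> m i"
  have ef: "buckling_eigenfunction \<sigma> l (\<Lambda> m i) w" and norm: "(LINT p:plate l|lborel. (w p)\<^sup>2) = 1"
    using sys mi unfolding buckling_system_def w_def by blast+
  have C4: "Ck_closed_plate l 4 w" using ef by (simp add: buckling_eigenfunction_def)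
  have C4': "Ck_closed_plate l (Suc (Suc (Suc (Suc 0)))) w" using C4 by (simp add: numeral_eq_Suc)
  obtain p where p: "p \<in> plate l" "w p \<noteq> 0" using ef by (auto simp: buckling_eigenfunction_def)
  have p': "p \<in> closed_plate l" using p plate_subset_closed_plate by auto
  have wxx: "dx (dx w) p = - (real m)\<^sup>2 * w p" unfolding w_def by (rule dx_mode_shape(2)[OF p'])
  have bilap: "laplacian l (laplacian l w) p = \<Lambda> m i * (real m)\<^sup>2 * w p"
    using ef p(1) by (auto simp: buckling_eigenfunction_def wxx)
  have C2: "C2_halfline \<phi>" and sol: "plate_solution \<sigma> l P S (\<lambda>t p. \<phi> t * w p)"
    using mode by (auto simp: simple_mode_def w_def)
  have coeff: "nonlocal_coeff l P S (\<lambda>p. c * w p) = - P + S * (c\<^sup>2 * (real m)\<^sup>2)" for c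
  proof -
    have "plate l \<in> sets lborel" by (simp add: plate_def open_Times borel_open)
    then have "(LINT p:plate l|lborel. (dx (\<lambda>p. c * w p) p)\<^sup>2) = (LINT p:plate l|lborel. c\<^sup>2 * (dx w p)\<^sup>2)"
    proof (rule set_lebesgue_integral_cong, intro allI impI)
      fix p assume "p \<in> plate l"
      then have "p \<in> closed_plate l" using plate_subset_closed_plate by blast
      from laplacian_scale(1)[OF assms(1) C4' this]
      show "(dx (\<lambda>p. c * w p) p)\<^sup>2 = c\<^sup>2 * (dx w p)\<^sup>2" by (simp add: power_mult_distrib)
    qed
    also have "\<dots> = c\<^sup>2 * (real m)\<^sup>2"
      using mode_shape_gradient_norm[of m l \<psi> i] mi norm C4' by (simp add: w_def)
    finally show ?thesis by (simp add: nonlocal_coeff_def)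
  qed
  have pos: "deriv_on {0..} (deriv_on {0..} \<phi>) s
     + ((real m)\<^sup>2 * (\<Lambda> m i - P) * \<phi> s + S * (real m)^4 * (\<phi> s)^3) = 0" if s: "s \<in> {0<..}" for s
  proof -
    have s0: "0 \<le> s" using s by simp
    have d1: "deriv_on {0..} (\<lambda>r. \<phi> r * w p) r = deriv_on {0..} \<phi> r * w p" if "0 \<le> r" for r
      by (rule deriv_on_eqI, rule at_within_halfline_neq_bot)
        (use that C2_halfline_derivs(1)[OF C2 that] in \<open>auto intro!: derivative_eq_intros\<close>)
    have "deriv_on {0..} (deriv_on {0..} (\<lambda>r. \<phi> r * w p)) s = deriv_on {0..} (\<lambda>r. deriv_on {0..} \<phi> r * w p) s"
      by (rule deriv_on_cong) (use d1 s in auto)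
    also have "\<dots> = deriv_on {0..} (deriv_on {0..} \<phi>) s * w p"
      by (rule deriv_on_eqI, rule at_within_halfline_neq_bot)
        (use s C2_halfline_derivs(2)[OF C2 s0] in \<open>auto intro!: derivative_eq_intros\<close>)
    finally have tt: "deriv_on {0..} (deriv_on {0..} (\<lambda>r. \<phi> r * w p)) s = deriv_on {0..} (deriv_on {0..} \<phi>) s * w p" .
    have "deriv_on {0..} (deriv_on {0..} (\<lambda>r. \<phi> r * w p)) s
          + laplacian l (laplacian l (\<lambda>p. \<phi> s * w p)) p
          - nonlocal_coeff l P S (\<lambda>p. \<phi> s * w p) * dx (dx (\<lambda>p. \<phi> s * w p)) p = 0"
      using sol p(1) s unfolding plate_solution_def by auto
    then have "w p * (deriv_on {0..} (deriv_on {0..} \<phi>) s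
     + ((real m)\<^sup>2 * (\<Lambda> m i - P) * \<phi> s + S * (real m)^4 * (\<phi> s)^3)) = 0"
      unfolding tt coeff bilaplacian_scale[OF assms(1) C4 p'] laplacian_scale(2)[OF assms(1) C4' p'] bilap wxx
      by (simp add: power_numeral_reduce algebra_simps)
    then show ?thesis using p(2) by simp
  qed
  have "continuous_on {0..} \<phi>" "continuous_on {0..} (deriv_on {0..} (deriv_on {0..} \<phi>))"
    using C2 by (auto simp: C2_halfline_def differentiable_imp_continuous_on)
  then have "continuous_on (closure {0<..}) (\<lambda>s. deriv_on {0..} (deriv_on {0..} \<phi>) s
     + ((real m)\<^sup>2 * (\<Lambda> m i - P) * \<phi> s + S * (real m)^4 * (\<phi> s)^3))"
    by (auto intro!: continuous_intros)
  from continuous_constant_on_closure[OF this pos, of t] t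
  have "deriv_on {0..} (deriv_on {0..} \<phi>) t
     + ((real m)\<^sup>2 * (\<Lambda> m i - P) * \<phi> t + S * (real m)^4 * (\<phi> t)^3) = 0" by simp
  then show ?thesis by linarith
qed

section \<open>Stability of simple modes of small energy\<close>

theorem theorem14:
  fixes \<sigma> l P S :: real
    and \<psi> :: "nat \<Rightarrow> nat \<Rightarrow> real \<Rightarrow> real" and \<Lambda> :: "nat \<Rightarrow> nat \<Rightarrow> real"
    and m n i k :: nat
  assumes "0 < \<sigma>" and "\<sigma> < 1 / 2" and "0 < l" and "0 < S"
    and "buckling_system \<sigma> l \<psi> \<Lambda>"
    and "1 \<le> m" and "1 \<le> n" and "1 \<le> i" and "1 \<le> k"
    and "P < min (\<Lambda> m i) (\<Lambda> n k)"
    and "real n / real m * sqrt ((\<Lambda> n k - P) / (\<Lambda> m i - P)) \<notin> \<nat> - {0} \<or>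
         (real n / real m * sqrt ((\<Lambda> n k - P) / (\<Lambda> m i - P)) \<in> \<nat> - {0} \<and>
          4 * n\<^sup>2 < 3 * m\<^sup>2)"
  shows "\<exists>E>0. \<forall>\<phi>. simple_mode \<sigma> l P S \<psi> m i \<phi> \<and> mode_energy P S \<Lambda> m i \<phi> 0 \<le> E \<longrightarrow>
           linearly_stable P S \<Lambda> m n k \<phi>"
proof -
  define \<omega> where "\<omega> = real m * sqrt (\<Lambda> m i - P)"
  define \<alpha> where "\<alpha> = real n * sqrt (\<Lambda> n k - P)"
  define \<kappa> where "\<kappa> = S * (real m)^4"
  define s where "s = S * (real m)\<^sup>2 * (real n)\<^sup>2"
  have pos: "0 < \<omega>" "0 < \<kappa>" "0 < \<alpha>" "0 \<le> s"
    using assms by (auto simp: \<omega>_def \<alpha>_def \<kappa>_def s_def)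
  have \<omega>2: "\<omega>\<^sup>2 = (real m)\<^sup>2 * (\<Lambda> m i - P)" and \<alpha>2: "\<alpha>\<^sup>2 = (real n)\<^sup>2 * (\<Lambda> n k - P)"
    using assms(10) by (auto simp: \<omega>_def \<alpha>_def power_mult_distrib)
  have ratio: "real n / real m * sqrt ((\<Lambda> n k - P) / (\<Lambda> m i - P)) = \<alpha> / \<omega>"
    by (simp add: \<alpha>_def \<omega>_def real_sqrt_divide)
  have "4 * s < 3 * \<kappa>" if "4 * n\<^sup>2 < 3 * m\<^sup>2"
  proof -
    have "real (4 * n\<^sup>2) < real (3 * m\<^sup>2)" using that by (simp only: of_nat_less_iff)
    then have "S * (real m)\<^sup>2 * (4 * (real n)\<^sup>2) < S * (real m)\<^sup>2 * (3 * (real m)\<^sup>2)"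
      using assms(4,6) by (intro mult_strict_left_mono) auto
    then show ?thesis by (simp add: s_def \<kappa>_def power_numeral_reduce algebra_simps)
  qed
  with assms(11) have res: "\<alpha> / \<omega> \<notin> \<nat> - {0} \<or> 4 * s < 3 * \<kappa>" unfolding ratio by blast
  obtain K a0 where a0: "0 < a0"
    and rot: "\<And>A. 0 < A \<Longrightarrow> A\<^sup>2 \<le> a0 \<Longrightarrow> real K * pi < \<alpha> * duffing_half_period \<omega> \<kappa> A"
    "\<And>A. 0 < A \<Longrightarrow> A\<^sup>2 \<le> a0 \<Longrightarrow>
       sqrt (\<alpha>\<^sup>2 + s * A\<^sup>2) * duffing_half_period \<omega> \<kappa> A < (real K + 1) * pi"
    by (rule small_amplitude_rotation[OF pos res]) (rule that)
  have "linearly_stable P S \<Lambda> m n k \<phi>"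
    if mode: "simple_mode \<sigma> l P S \<psi> m i \<phi>" and small: "mode_energy P S \<Lambda> m i \<phi> 0 \<le> \<omega>\<^sup>2 * a0 / 2" for \<phi>
  proof -
    define \<psi>' where "\<psi>' = deriv_on {0..} \<phi>"
    have C2: "C2_halfline \<phi>" using mode by (simp add: simple_mode_def)
    have d1: "(\<phi> has_real_derivative \<psi>' t) (at t within {0..})" if "0 \<le> t" for t
      unfolding \<psi>'_def by (rule C2_halfline_derivs(1)[OF C2 that])
    have d2: "(\<psi>' has_real_derivative - (\<omega>\<^sup>2 * \<phi> t + \<kappa> * (\<phi> t)^3)) (at t within {0..})" if "0 \<le> t" for t
      using C2_halfline_derivs(2)[OF C2 that]
      unfolding \<psi>'_def simple_mode_duffing[OF assms(3,5,6,8) mode that] \<omega>2 \<kappa>_def .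
    have en: "mode_energy P S \<Lambda> m i \<phi> 0 = (\<psi>' 0)\<^sup>2 / 2 + \<omega>\<^sup>2 * (\<phi> 0)\<^sup>2 / 2 + \<kappa> * (\<phi> 0)^4 / 4"
      by (simp add: mode_energy_def \<psi>'_def \<omega>2 \<kappa>_def)
    then have "0 \<le> mode_energy P S \<Lambda> m i \<phi> 0" using pos by simp
    then obtain A where A: "0 \<le> A" "\<omega>\<^sup>2 * A\<^sup>2 / 2 + \<kappa> * A^4 / 4 = mode_energy P S \<Lambda> m i \<phi> 0"
        "A\<^sup>2 \<le> 2 * mode_energy P S \<Lambda> m i \<phi> 0 / \<omega>\<^sup>2"
      using duffing_amplitude_exists[OF pos(1,2)] by blast
    have "2 * mode_energy P S \<Lambda> m i \<phi> 0 / \<omega>\<^sup>2 \<le> a0"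
      using small pos(1) by (simp add: pos_divide_le_eq mult.commute)
    with A(3) have Aa0: "A\<^sup>2 \<le> a0" by linarith
    have bound: "(\<phi> t)\<^sup>2 \<le> A\<^sup>2" if "0 \<le> t" for t
    proof (rule duffing_amplitude_bound[OF pos(1,2)])
      have "(\<psi>' t)\<^sup>2 / 2 + \<omega>\<^sup>2 * (\<phi> t)\<^sup>2 / 2 + \<kappa> * (\<phi> t)^4 / 4
          = (\<psi>' 0)\<^sup>2 / 2 + \<omega>\<^sup>2 * (\<phi> 0)\<^sup>2 / 2 + \<kappa> * (\<phi> 0)^4 / 4"
        by (rule duffing_energy_conserved[of \<phi> \<psi>' \<omega> \<kappa> t]) (fact d1 d2 that)+
      then show "(\<psi>' t)\<^sup>2 / 2 + \<omega>\<^sup>2 * (\<phi> t)\<^sup>2 / 2 + \<kappa> * (\<phi> t)^4 / 4 = \<omega>\<^sup>2 * A\<^sup>2 / 2 + \<kappa> * A^4 / 4"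
        using A(2) en by simp
    qed
    define a where "a t = \<alpha>\<^sup>2 + s * (\<phi> t)\<^sup>2" for t
    have cont: "continuous_on {0..} a"
      unfolding a_def using d1 by (intro continuous_intros DERIV_continuous_on) auto
    have lower: "\<alpha>\<^sup>2 \<le> a t" if "0 \<le> t" for t using pos by (simp add: a_def)
    define B where "B = sqrt (\<alpha>\<^sup>2 + s * A\<^sup>2)"
    have "0 < \<alpha>\<^sup>2 + s * A\<^sup>2" using pos by (intro add_pos_nonneg) auto
    then have B: "0 < B" "B\<^sup>2 = \<alpha>\<^sup>2 + s * A\<^sup>2" by (auto simp: B_def)
    have upper: "a t \<le> B\<^sup>2" if "0 \<le> t" for t
      unfolding B a_def using bound[OF that] pos by (intro add_left_mono mult_left_mono) auto
    have "hill_zero_stable a"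
    \<comment> \<open>For the mode at rest the coefficient is constant and every number is a period; a quarter of
      the period of \<open>\<xi>\<close> lies in the middle of the lowest band.\<close>
    proof (cases "A = 0")
      case True
      have \<phi>0: "\<phi> t = 0" if "0 \<le> t" for t using bound[OF that] True by simp
      have rots: "real 0 * pi < \<alpha> * (pi / (2 * \<alpha>))" "B * (pi / (2 * \<alpha>)) < (real 0 + 1) * pi"
        using pos True by (auto simp: B_def field_simps)
      have per: "a (t + pi / (2 * \<alpha>)) = a t" if "0 \<le> t" for t
        using \<phi>0[OF that] \<phi>0[of "t + pi / (2 * \<alpha>)"] that pos by (simp add: a_def)
      have "0 < pi / (2 * \<alpha>)" using pos by simp
      show ?thesis
        by (rule zhukovskii_zero_stable[of a "pi / (2 * \<alpha>)" \<alpha> B 0])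
          (fact cont per lower upper pos(3) B(1) rots \<open>0 < pi / (2 * \<alpha>)\<close>)+
    next
      case False
      with A(1) have A0: "0 < A" by simp
      define \<tau> where "\<tau> = duffing_half_period \<omega> \<kappa> A"
      have "0 < pi / sqrt (\<omega>\<^sup>2 + \<kappa> * A\<^sup>2)" using pos by (simp add: add_pos_nonneg)
      then have \<tau>: "0 < \<tau>"
        using duffing_half_period_bounds(1)[OF pos(1,2), of A] unfolding \<tau>_def by linarith
      have per: "a (t + \<tau>) = a t" if "0 \<le> t" for t
      proof -
        have "\<phi> (t + \<tau>) = - \<phi> t"
          unfolding \<tau>_def
          by (rule duffing_half_period_antiperiodic[of \<phi> \<psi>', OF _ _ pos(1,2) A0 en[unfolded A(2)[symmetric], symmetric] that])
            (fact d1 d2)+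
        then show ?thesis by (simp add: a_def)
      qed
      have rots: "real K * pi < \<alpha> * \<tau>" "B * \<tau> < (real K + 1) * pi"
        using rot[OF A0 Aa0] by (auto simp: \<tau>_def B_def)
      show ?thesis
        by (rule zhukovskii_zero_stable[of a \<tau> \<alpha> B K])
          (fact cont per lower upper pos(3) B(1) \<tau> rots)+
    qed
    then show ?thesis
      by (simp add: linearly_stable_def a_def[abs_def] \<alpha>2 s_def)
  qed
  moreover have "0 < \<omega>\<^sup>2 * a0 / 2" using a0 pos by simp
  ultimately show ?thesis by blast
qed

end
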